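(* Let $X$ and $Y$ be Banach spaces (real or complex, over the same field) and $n\in\mathbb{N}$, $n\geq 1$. Suppose that a set $E$ of uniformly strongly exposed points on $S_X$ is a norming subset for $P(^nX,Y)$. Then the set of all norm-attaining elements is dense in $P(^nX,Y)$. Especially, if a uniformly strongly exposed set $E\subset S_X$ is dense in $S_X$, then the set of norm-attaining elements is dense in $P(^nX,Y)$. Moreover, if $X$ and $Y$ are complex Banach spaces and the set of strongly exposed points of $B_X$ is dense in $S_X$, then the set of norm-attaining elements is dense in $A(B_X,Y)$, where $A(B_X,Y)$ denotes either $A_u(B_X,Y)$ or $A_b(B_X,Y)$.
   Context: $B_X$, $S_X$ are the closed unit ball and unit sphere of $X$. $P(^nX,Y)$ is the Banach space of bounded $n$-homogeneous polynomials from $X$ into $Y$ with norm $\|P\|=\sup_{x\in B_X}\|P(x)\|$. A set $E\subset S_X$ is norming for $P(^nX,Y)$ if $\|P\|=\sup_{x\in E}\|P(x)\|$ for all $P$. A function $f$ on $B_X$ is norm-attaining if $\|f(x)\|=\|f\|=\sup_{B_X}\|f\|$ for some $x\in B_X$. A set $\{x_\alpha\}\subset S_X$ is uniformly strongly exposed if there are a function $\delta(\epsilon)$ with $\delta(\epsilon)>0$ for every $\epsilon>0$ and functionals $f_\alpha\in X^*$ of norm $1$ such that for every $\alpha$, $f_\alpha(x_\alpha)=1$, and for any $x$, $\|x\|\le1$ and $\operatorname{Re}f_\alpha(x)\ge1-\delta(\epsilon)$ imply $\|x-x_\alpha\|\le\epsilon$. $x\in B_X$ is a strongly exposed point of $B_X$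 if there is $f\in B_{X^*}$ with $f(x)=1$ such that whenever $\{x_n\}\subset B_X$ satisfies $\lim_n\operatorname{Re}f(x_n)=1$, then $\lim_n\|x_n-x\|=0$. $A_b(B_X,Y)$ is the Banach space (sup norm) of bounded continuous functions $B_X\to Y$ analytic on the interior of $B_X$; $A_u(B_X,Y)$ is its subspace of functions uniformly continuous on $B_X$. *)

theory Defs
  imports "HOL-Analysis.Analysis"
begin

(* The axioms leave only two possibilities: either imag_unit = 0 and the field is the reals,
   or imag_unit squares to -1 and the field is the complex numbers with its usual norm. *)
class real_or_complex = real_normed_field +
  fixes re_part :: "'a \<Rightarrow> real"
    and im_part :: "'a \<Rightarrow> real"
    and imag_unit :: 'a
  assumes re_im_decomp: "z = re_part z *\<^sub>R 1 + im_part z *\<^sub>R imag_unit"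
    and norm_sq_re_im: "(norm z)\<^sup>2 = (re_part z)\<^sup>2 + (im_part z)\<^sup>2"
    and imag_unit_cases: "imag_unit = 0 \<and> im_part z = 0 \<or> imag_unit * imag_unit = - 1"

instantiation real :: real_or_complex
begin
definition re_part_real :: "real \<Rightarrow> real" where "re_part_real x = x"
definition im_part_real :: "real \<Rightarrow> real" where "im_part_real x = 0"
definition imag_unit_real :: real where "imag_unit_real = 0"
instance
  by standard (simp_all add: re_part_real_def im_part_real_def imag_unit_real_def)
end

instantiation complex :: real_or_complex
begin
definition re_part_complex :: "complex \<Rightarrow> real" where "re_part_complex = Re"
definition im_part_complex :: "complex \<Rightarrow> real" where "im_part_complex = Im"
definition imag_unit_complex :: complex where "imag_unit_complex = \<i>"
instance
  by standard
    (simp_all add: re_part_complex_def im_part_complex_def imag_unit_complex_def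
      cmod_power2 complex_eq_iff)
end

(* A normed space over 'k is a real normed space with a scalar multiplication by 'k that extends
   the real one; it is a Banach space over 'k when the underlying type is of class banach. *)
locale normed_space_over = vector_space scale
  for scale :: "'k::real_or_complex \<Rightarrow> 'a::real_normed_vector \<Rightarrow> 'a" +
  assumes scale_of_real: "scale (of_real r) x = r *\<^sub>R x"
    and norm_scale: "norm (scale c x) = norm c * norm x"

definition dual_space :: "('k::real_or_complex \<Rightarrow> 'a::real_normed_vector \<Rightarrow> 'a) \<Rightarrow> ('a \<Rightarrow> 'k) set"
  where "dual_space s = {f. Vector_Spaces.linear s (*) f \<and> bounded_linear f}"

definition sup_norm :: "('a::real_normed_vector \<Rightarrow> 'b::real_normed_vector) \<Rightarrow> real"
  where "sup_norm f = (SUP x\<in>cball 0 1. norm (f x))"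

definition norm_attaining :: "('a::real_normed_vector \<Rightarrow> 'b::real_normed_vector) \<Rightarrow> bool"
  where "norm_attaining f \<longleftrightarrow> (\<exists>x\<in>cball 0 1. norm (f x) = sup_norm f)"

definition sup_norm_dense_in ::
    "('a::real_normed_vector \<Rightarrow> 'b::real_normed_vector) set \<Rightarrow> ('a \<Rightarrow> 'b) set \<Rightarrow> bool"
  where "sup_norm_dense_in D F \<longleftrightarrow>
    D \<subseteq> F \<and> (\<forall>f\<in>F. \<forall>\<epsilon>>0. \<exists>g\<in>D. sup_norm (\<lambda>x. f x - g x) < \<epsilon>)"

(* An n-linear map takes its n arguments as a list of length n; for n = 0 there is no condition. *)
definition multilinear ::
    "('k::real_or_complex \<Rightarrow> 'a::real_normed_vector \<Rightarrow> 'a) \<Rightarrow>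
     ('k \<Rightarrow> 'b::real_normed_vector \<Rightarrow> 'b) \<Rightarrow> nat \<Rightarrow> ('a list \<Rightarrow> 'b) \<Rightarrow> bool"
  where "multilinear sX sY n L \<longleftrightarrow>
    (\<forall>xs. length xs = n \<longrightarrow> (\<forall>i<n. Vector_Spaces.linear sX sY (\<lambda>x. L (xs[i := x]))))"

definition bounded_hom_polys ::
    "('k::real_or_complex \<Rightarrow> 'a::real_normed_vector \<Rightarrow> 'a) \<Rightarrow>
     ('k \<Rightarrow> 'b::real_normed_vector \<Rightarrow> 'b) \<Rightarrow> nat \<Rightarrow> ('a \<Rightarrow> 'b) set"
  where "bounded_hom_polys sX sY n =
    {P. (\<exists>L. multilinear sX sY n L \<and> (\<forall>x. P x = L (replicate n x))) \<and> bounded (P ` cball 0 1)}"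

definition norming ::
    "('k::real_or_complex \<Rightarrow> 'a::real_normed_vector \<Rightarrow> 'a) \<Rightarrow>
     ('k \<Rightarrow> 'b::real_normed_vector \<Rightarrow> 'b) \<Rightarrow> nat \<Rightarrow> 'a set \<Rightarrow> bool"
  where "norming sX sY n E \<longleftrightarrow>
    E \<subseteq> sphere 0 1 \<and> (\<forall>P\<in>bounded_hom_polys sX sY n. sup_norm P = (SUP x\<in>E. norm (P x)))"

definition uniformly_strongly_exposed ::
    "('k::real_or_complex \<Rightarrow> 'a::real_normed_vector \<Rightarrow> 'a) \<Rightarrow> 'a set \<Rightarrow> bool"
  where "uniformly_strongly_exposed s E \<longleftrightarrow>
    E \<subseteq> sphere 0 1 \<and>
    (\<exists>(\<delta> :: real \<Rightarrow> real) (f :: 'a \<Rightarrow> 'a \<Rightarrow> 'k).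
      (\<forall>\<epsilon>>0. \<delta> \<epsilon> > 0) \<and>
      (\<forall>a\<in>E. f a \<in> dual_space s \<and> onorm (f a) = 1 \<and> f a a = 1 \<and>
        (\<forall>\<epsilon>>0. \<forall>x. norm x \<le> 1 \<and> re_part (f a x) \<ge> 1 - \<delta> \<epsilon> \<longrightarrow> norm (x - a) \<le> \<epsilon>)))"

definition strongly_exposed_point ::
    "('k::real_or_complex \<Rightarrow> 'a::real_normed_vector \<Rightarrow> 'a) \<Rightarrow> 'a \<Rightarrow> bool"
  where "strongly_exposed_point s x \<longleftrightarrow>
    x \<in> cball 0 1 \<and>
    (\<exists>f\<in>dual_space s. onorm f \<le> 1 \<and> f x = 1 \<and>
      (\<forall>u :: nat \<Rightarrow> 'a. range u \<subseteq> cball 0 1 \<and> (\<lambda>n. re_part (f (u n))) \<longlonglongrightarrow> 1 \<longrightarrow>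
        (\<lambda>n. norm (u n - x)) \<longlonglongrightarrow> 0))"

definition banach_analytic_on ::
    "('k::real_or_complex \<Rightarrow> 'a::real_normed_vector \<Rightarrow> 'a) \<Rightarrow>
     ('k \<Rightarrow> 'b::real_normed_vector \<Rightarrow> 'b) \<Rightarrow> 'a set \<Rightarrow> ('a \<Rightarrow> 'b) \<Rightarrow> bool"
  where "banach_analytic_on sX sY U f \<longleftrightarrow>
    (\<forall>a\<in>U. \<exists>r>0. ball a r \<subseteq> U \<and>
      (\<exists>P. (\<forall>m. P m \<in> bounded_hom_polys sX sY m) \<and>
        uniform_limit (ball a r) (\<lambda>N x. \<Sum>m<N. P m (x - a)) f sequentially))"

(* Functions on the closed unit ball are represented by total functions whose values outside the
   ball are unconstrained and are ignored by sup_norm and norm_attaining. *)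
definition A_b ::
    "(complex \<Rightarrow> 'a::real_normed_vector \<Rightarrow> 'a) \<Rightarrow>
     (complex \<Rightarrow> 'b::real_normed_vector \<Rightarrow> 'b) \<Rightarrow> ('a \<Rightarrow> 'b) set"
  where "A_b sX sY =
    {f. bounded (f ` cball 0 1) \<and> continuous_on (cball 0 1) f \<and>
        banach_analytic_on sX sY (interior (cball 0 1)) f}"

definition A_u ::
    "(complex \<Rightarrow> 'a::real_normed_vector \<Rightarrow> 'a) \<Rightarrow>
     (complex \<Rightarrow> 'b::real_normed_vector \<Rightarrow> 'b) \<Rightarrow> ('a \<Rightarrow> 'b) set"
  where "A_u sX sY = {f \<in> A_b sX sY. uniformly_continuous_on (cball 0 1) f}"

end

theory Submission
  imports Defs
begin

text \<open>
  The proof follows Lindenstrauss: perturb \<open>f\<close> repeatedly by small bumps \<open>\<phi>\<^sub>k v\<^sub>k\<close> that peak at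
  exposed points \<open>x\<^sub>k\<close> where \<open>f\<^sub>k\<close> almost attains its norm, with \<open>v\<^sub>k\<close> in the direction of
  \<open>f\<^sub>k(x\<^sub>k)\<close>. Then all almost-maximal points of \<open>f\<^sub>k + \<phi>\<^sub>k v\<^sub>k\<close> cluster near \<open>x\<^sub>k\<close>, and this
  survives the later, much smaller perturbations. An almost-maximizing sequence of the limit is
  therefore Cauchy. For \<open>n\<close>-homogeneous polynomials the bumps are \<open>\<phi>\<^sup>n\<close>, which peak only up to
  unimodular scalars and whose sharpness is uniform because the exposure is; for analytic functions
  they are \<open>((1 + \<phi>)/2)\<^sup>N\<close>, where \<open>N\<close> can be taken as large as needed, so that no
  uniformity of the exposure is required. In the analytic case the maximum principle shows that the
  norm is almost attained on the sphere.
\<close>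

section \<open>Perturbation by bumps\<close>

text \<open>Without compactness an almost maximizing sequence need not converge; the bumps force it
  to, and completeness of the domain then supplies the maximum point. The order of choices shapes
  the argument. At step \<open>k\<close> the height \<open>e\<close> of the bump is limited by the
  earlier steps, and the peak point must be within \<open>e * t / 2\<close> of the supremum, where
  \<open>t\<close> measures the sharpness of a bump that is chosen only together with its point.
  Hence \<open>t\<close> has to be fixed by the desired radius alone. For polynomials uniform
  exposure provides this: the exponent is tied to the degree \<open>n\<close> and cannot be raised
  to sharpen a bump. For analytic functions the exponent is free and \<open>t = 1/2\<close> always
  works. The map \<open>(1 + w) / 2\<close> breaks the rotational symmetry of \<open>w\<close>:
  modulus close to 1 then forces \<open>w\<close> itself close to 1. Polynomials need no such break,
  because unimodular factors in the argument do not change the norm of their values.\<close>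

lemma norm_le_sup_norm:
  assumes "bounded (f ` cball 0 1)" "x \<in> cball 0 1"
  shows "norm (f x) \<le> sup_norm f"
proof -
  have "bdd_above ((\<lambda>x. norm (f x)) ` cball 0 1)"
    using assms(1) by (auto simp: bounded_iff bdd_above_def)
  then show ?thesis
    unfolding sup_norm_def using assms(2) by (rule cSUP_upper2) auto
qed

lemma sup_norm_le:
  fixes f :: "'a::real_normed_vector \<Rightarrow> 'b::real_normed_vector"
  assumes "\<And>x. x \<in> cball 0 1 \<Longrightarrow> norm (f x) \<le> c"
  shows "sup_norm f \<le> c"
proof -
  have "(0::'a) \<in> cball 0 1" by simp
  then show ?thesis unfolding sup_norm_def by (intro cSUP_least assms) blast+
qed

lemma ex_norm_gt_sup_norm_minus:
  fixes f :: "'a::real_normed_vector \<Rightarrow> 'b::real_normed_vector"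
  assumes "\<eta> > 0"
  obtains x where "x \<in> cball 0 1" "norm (f x) > sup_norm f - \<eta>"
proof (rule ccontr)
  assume "\<not> thesis"
  then have "norm (f x) \<le> sup_norm f - \<eta>" if "x \<in> cball 0 1" for x
    using that \<open>\<And>x. \<lbrakk>x \<in> cball 0 1; norm (f x) > sup_norm f - \<eta>\<rbrakk> \<Longrightarrow> thesis\<close> by (meson not_less)
  then have "sup_norm f \<le> sup_norm f - \<eta>" by (rule sup_norm_le)
  with assms show False by simp
qed

lemma bounded_image_cballI:
  assumes "\<And>x. x \<in> cball 0 1 \<Longrightarrow> norm (f x) \<le> c"
  shows "bounded (f ` cball 0 1)"
  unfolding bounded_iff using assms by blast

text \<open>The point \<open>z''\<close> is \<open>z'\<close> itself or, for polynomials, a rotation of \<open>z'\<close>.\<close>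

definition near_max_clustered ::
    "('a::real_normed_vector \<Rightarrow> 'b::real_normed_vector) set \<Rightarrow> ('a \<Rightarrow> 'b) \<Rightarrow> real \<Rightarrow> real \<Rightarrow> bool"
  where "near_max_clustered F h r \<eta> \<longleftrightarrow>
    (\<forall>z\<in>cball 0 1. \<forall>z'\<in>cball 0 1. norm (h z) > sup_norm h - \<eta> \<and> norm (h z') > sup_norm h - \<eta> \<longrightarrow>
      (\<exists>z''\<in>cball 0 1. (\<forall>g\<in>F. norm (g z'') = norm (g z')) \<and> norm (z'' - z) < r))"

lemma near_max_clusteredD:
  assumes "near_max_clustered F h r \<eta>" "z \<in> cball 0 1" "z' \<in> cball 0 1"
    "norm (h z) > sup_norm h - \<eta>" "norm (h z') > sup_norm h - \<eta>"
  shows "\<exists>z''\<in>cball 0 1. (\<forall>g\<in>F. norm (g z'') = norm (g z')) \<and> norm (z'' - z) < r"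
  using assms unfolding near_max_clustered_def by blast

lemma near_max_clustered_mono:
  assumes "near_max_clustered F h r \<eta>" "\<eta>' \<le> \<eta>"
  shows "near_max_clustered F h r \<eta>'"
  using assms unfolding near_max_clustered_def by (meson diff_left_mono le_less_trans)

text \<open>A near-maximum of \<open>h\<close> loses \<open>\<eta> / 4\<close> by its own tolerance,
  \<open>\<eta> / 4\<close> in passing to \<open>f\<close> and \<open>\<eta> / 4\<close> in
  comparing the suprema: \<open>3 * \<eta> / 4\<close> in all, so the clustering of \<open>f\<close>
  applies.\<close>

lemma near_max_clustered_perturb:
  assumes "near_max_clustered F f r \<eta>" "bounded (h ` cball 0 1)"
    and "\<And>z. z \<in> cball 0 1 \<Longrightarrow> norm (h z - f z) \<le> \<eta> / 4"
  shows "near_max_clustered F h r (\<eta> / 4)"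
proof -
  have "norm (f z) \<le> sup_norm h + \<eta> / 4" if "z \<in> cball 0 1" for z
    using assms(3)[OF that] norm_le_sup_norm[OF assms(2) that] norm_triangle_ineq2[of "f z" "h z"]
    by (simp add: norm_minus_commute)
  then have S: "sup_norm f \<le> sup_norm h + \<eta> / 4" by (rule sup_norm_le)
  have *: "norm (f z) > sup_norm f - \<eta>" if "z \<in> cball 0 1" "norm (h z) > sup_norm h - \<eta> / 4" for z
  proof -
    have "0 \<le> \<eta> / 4" using assms(3)[OF that(1)] norm_ge_zero order_trans by blast
    then show ?thesis
      using assms(3)[OF that(1)] that(2) S norm_triangle_ineq2[of "h z" "f z"] by linarith
  qed
  show ?thesis
    using assms(1) * unfolding near_max_clustered_def by blast
qed

text \<open>Clustering compares any two near-maxima, so each better near-maximum can be replaced by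
  a point of equal norm close to its predecessor. The steps are summable; completeness of the domain
  gives a limit, and continuity makes it a maximum point.\<close>

lemma norm_attaining_if_clustered:
  fixes h :: "'a::banach \<Rightarrow> 'b::real_normed_vector"
  assumes "h \<in> F" "bounded (h ` cball 0 1)" "continuous_on (cball 0 1) h"
    and cl: "\<And>r. r > 0 \<Longrightarrow> \<exists>\<eta>>0. near_max_clustered F h r \<eta>"
  shows "norm_attaining h"
proof -
  \<comment> \<open>The tolerance \<open>\<theta>\<close> is stored with the point: clustering at
    scale \<open>k\<close> holds at this tolerance, and \<open>w\<close> meets it. The bound
    \<open>1 / real (Suc k)\<close> makes the norms tend to the supremum.\<close>
  define P where "P k = (\<lambda>(w, \<theta>). w \<in> cball 0 1 \<and> \<theta> > 0 \<and> \<theta> \<le> 1 / real (Suc k) \<and>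
      near_max_clustered F h ((1/2)^k) \<theta> \<and> norm (h w) > sup_norm h - \<theta>)" for k :: nat
  define Q where "Q k = (\<lambda>p q :: 'a \<times> real. norm (fst q - fst (p :: 'a \<times> real)) < (1/2)^k)" for k :: nat
  have "\<exists>s. \<forall>k. P k (s k) \<and> Q k (s k) (s (Suc k))"
  proof (rule dependent_nat_choice)
    obtain \<eta> where e: "\<eta> > 0" "near_max_clustered F h 1 \<eta>" using cl[of 1] by auto
    define \<theta> where "\<theta> = min \<eta> 1"
    obtain x where "x \<in> cball 0 1" "norm (h x) > sup_norm h - \<theta>"
      using ex_norm_gt_sup_norm_minus[of \<theta> h] e by (auto simp: \<theta>_def)
    with e have "P 0 (x, \<theta>)" by (auto simp: P_def \<theta>_def intro: near_max_clustered_mono)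
    then show "\<exists>p. P 0 p" ..
  next
    fix p k assume "P k p"
    then obtain w \<theta> where p: "p = (w, \<theta>)" and w: "w \<in> cball 0 1" "\<theta> > 0"
      "near_max_clustered F h ((1/2)^k) \<theta>" "norm (h w) > sup_norm h - \<theta>"
      by (auto simp: P_def)
    obtain \<eta> where e: "\<eta> > 0" "near_max_clustered F h ((1/2)^Suc k) \<eta>"
      using cl[of "(1/2)^Suc k"] by auto
    \<comment> \<open>Being also at most \<open>\<theta>\<close>, the new tolerance leaves the new
      point a near-maximum at the previous scale, where it is compared with
      \<open>w\<close>.\<close>
    define \<theta>' where "\<theta>' = min (min \<eta> \<theta>) (1 / real (Suc (Suc k)))"
    have t: "\<theta>' > 0" "\<theta>' \<le> \<eta>" "\<theta>' \<le> \<theta>" "\<theta>' \<le> 1 / real (Suc (Suc k))"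
      using w e by (auto simp: \<theta>'_def)
    obtain x where x: "x \<in> cball 0 1" "norm (h x) > sup_norm h - \<theta>'"
      using ex_norm_gt_sup_norm_minus[of \<theta>' h] t by auto
    then obtain w' where w': "w' \<in> cball 0 1" "norm (h w') = norm (h x)" "norm (w' - w) < (1/2)^k"
    proof -
      have "norm (h x) > sup_norm h - \<theta>" using x(2) t(3) by linarith
      then obtain w' where "w' \<in> cball 0 1" "\<forall>g\<in>F. norm (g w') = norm (g x)" "norm (w' - w) < (1/2)^k"
        using near_max_clusteredD[OF w(3,1) x(1) w(4)] by blast
      with \<open>h \<in> F\<close> that show ?thesis by blast
    qed
    then have "P (Suc k) (w', \<theta>') \<and> Q k p (w', \<theta>')"
      using e t x by (auto simp: P_def Q_def p intro: near_max_clustered_mono)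
    then show "\<exists>q. P (Suc k) q \<and> Q k p q" ..
  qed
  then obtain s where s: "\<And>k. P k (s k)" "\<And>k. Q k (s k) (s (Suc k))" by auto
  define w where "w k = fst (s k)" for k
  have w: "w k \<in> cball 0 1" "norm (h (w k)) \<ge> sup_norm h - 1 / real (Suc k)"
    "norm (w (Suc k) - w k) \<le> (1/2)^k" for k
    using s(1)[of k] s(2)[of k] by (auto simp: P_def Q_def w_def split: prod.splits)
  have "summable (\<lambda>k. w (Suc k) - w k)"
    by (rule summable_comparison_test'[where g = "\<lambda>k. (1/2)^k"]) (use w(3) in auto)
  then have "convergent (\<lambda>n. (\<Sum>k<n. w (Suc k) - w k) + w 0)"
    by (intro convergent_add convergent_const) (simp add: summable_iff_convergent)
  then have "convergent w" by (simp add: sum_lessThan_telescope)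
  then obtain x where x: "w \<longlonglongrightarrow> x" by (auto simp: convergent_def)
  have xB: "x \<in> cball 0 1"
    using closed_sequentially[OF closed_cball _ x] w(1) by blast
  have "(\<lambda>k. norm (h (w k))) \<longlonglongrightarrow> norm (h x)"
    by (intro tendsto_norm continuous_on_tendsto_compose[OF assms(3) x]) (use xB w in auto)
  moreover have "(\<lambda>k. sup_norm h - 1 / real (Suc k)) \<longlonglongrightarrow> sup_norm h - 0"
    by (intro tendsto_intros LIMSEQ_Suc lim_1_over_n)
  ultimately have "sup_norm h \<le> norm (h x)"
    using w(2) by (auto intro: LIMSEQ_le)
  with norm_le_sup_norm[OF assms(2) xB] xB show ?thesis
    by (auto simp: norm_attaining_def intro!: bexI[of _ x])
qed

lemma sup_norm_dense_in_self:
  assumes "\<And>f. f \<in> F \<Longrightarrow> norm_attaining f"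
  shows "sup_norm_dense_in {f \<in> F. norm_attaining f} F"
proof -
  have "sup_norm (\<lambda>x. f x - f x) < \<epsilon>" if "\<epsilon> > 0" for f :: "'a \<Rightarrow> 'b" and \<epsilon>
    by (rule le_less_trans[OF sup_norm_le that]) simp
  with assms show ?thesis unfolding sup_norm_dense_in_def by blast
qed

text \<open>In the zero space the sphere is empty and offers no point to perturb at, so this case is
  settled apart.\<close>

lemma norm_attaining_trivial_domain:
  fixes f :: "'a::real_normed_vector \<Rightarrow> 'b::real_normed_vector"
  assumes "\<And>x::'a. x = 0"
  shows "norm_attaining f"
proof -
  have "cball 0 1 = {0::'a}" using assms by auto
  then show ?thesis by (simp add: norm_attaining_def sup_norm_def)
qed

lemma norm_attaining_if_sup_norm_le_0:
  fixes f :: "'a::real_normed_vector \<Rightarrow> 'b::real_normed_vector"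
  assumes "bounded (f ` cball 0 1)" "sup_norm f \<le> 0"
  shows "norm_attaining f"
proof -
  have "norm (f 0) \<le> sup_norm f" using norm_le_sup_norm[OF assms(1)] by simp
  with assms(2) have "norm (f 0) = sup_norm f" using norm_ge_zero[of "f 0"] by linarith
  then show ?thesis by (auto simp: norm_attaining_def intro!: bexI[of _ 0])
qed

section \<open>Scalar actions and the effect of a single bump\<close>

context normed_space_over
begin

lemma bounded_linear_scale_right: "bounded_linear (scale c)"
proof (intro bounded_linear_intro[where K = "norm c"])
  fix r :: real and x :: 'a
  have "scale c (scale (of_real r) x) = scale (of_real r) (scale c x)"
    by (rule scale_left_commute)
  then show "scale c (r *\<^sub>R x) = r *\<^sub>R scale c x" by (simp only: scale_of_real)
qed (simp_all add: scale_right_distrib norm_scale mult.commute)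

lemma bounded_linear_scale_left: "bounded_linear (\<lambda>c. scale c x)"
proof (intro bounded_linear_intro[where K = "norm x"])
  fix r :: real and c :: 'k
  show "scale (r *\<^sub>R c) x = r *\<^sub>R scale c x"
    by (simp only: scaleR_conv_of_real scale_scale[symmetric] scale_of_real)
qed (simp_all add: scale_left_distrib norm_scale)

end

text \<open>A bump of height \<open>e\<close> in this direction lifts the norm at its peak by the
  full \<open>e\<close>. At \<open>x = 0\<close> any unit vector serves, which is why the space must
  be nonzero.\<close>

lemma ex_unit_vector_same_direction:
  fixes x :: "'b::real_normed_vector"
  assumes "\<exists>v::'b. v \<noteq> 0"
  obtains y :: 'b where "norm y = 1" "\<And>e. e \<ge> 0 \<Longrightarrow> norm (x + e *\<^sub>R y) = norm x + e"
proof (cases "x = 0")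
  case True
  obtain v :: 'b where "v \<noteq> 0" using assms by blast
  with that[of "sgn v"] True show ?thesis by (simp add: norm_sgn)
next
  case False
  have "norm (x + e *\<^sub>R sgn x) = norm x + e" if "e \<ge> 0" for e
  proof -
    have "x + e *\<^sub>R sgn x = (norm x + e) *\<^sub>R sgn x"
      using False by (simp add: sgn_div_norm scaleR_left_distrib distrib_right)
    then show ?thesis using False that by (simp add: norm_sgn)
  qed
  with that[of "sgn x"] False show ?thesis by (simp add: norm_sgn)
qed

text \<open>No peak point is named: two points are compared with each other, since the bump of a
  polynomial is large near all rotations of its peak and only the passage to \<open>z''\<close>
  brings these together.\<close>

definition peaks_within ::
    "('a::real_normed_vector \<Rightarrow> 'b::real_normed_vector) set \<Rightarrow> ('a \<Rightarrow> 'k::real_normed_vector) \<Rightarrow> real \<Rightarrow> real \<Rightarrow> bool"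
  where "peaks_within F \<phi> t r \<longleftrightarrow>
    (\<forall>z\<in>cball 0 1. \<forall>z'\<in>cball 0 1. norm (\<phi> z) > 1 - t \<and> norm (\<phi> z') > 1 - t \<longrightarrow>
      (\<exists>z''\<in>cball 0 1. (\<forall>g\<in>F. norm (g z'') = norm (g z')) \<and> norm (z'' - z) < r))"

text \<open>At \<open>x\<close> the perturbed norm exceeds
  \<open>sup_norm f + \<epsilon> - \<epsilon> * t / 2\<close>; at any \<open>z\<close> of the ball
  it is at most \<open>sup_norm f + \<epsilon> * norm (\<phi> z)\<close>. A further loss of
  \<open>\<epsilon> * t / 2\<close> therefore still forces
  \<open>norm (\<phi> z) > 1 - t\<close>.\<close>

lemma near_max_clustered_bump:
  fixes sY :: "'k::real_or_complex \<Rightarrow> 'b::real_normed_vector \<Rightarrow> 'b"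
  assumes "normed_space_over sY" "\<epsilon> > 0" "t > 0"
    and bd: "bounded (f ` cball 0 1)" "bounded ((\<lambda>z. f z + sY (\<phi> z) (\<epsilon> *\<^sub>R y)) ` cball 0 1)"
    and x: "x \<in> cball 0 1" "norm (f x) > sup_norm f - \<epsilon> * t / 2" "\<phi> x = 1"
    and y: "norm y = 1" "norm (f x + \<epsilon> *\<^sub>R y) = norm (f x) + \<epsilon>"
    and cl: "peaks_within F \<phi> t r"
  shows "near_max_clustered F (\<lambda>z. f z + sY (\<phi> z) (\<epsilon> *\<^sub>R y)) r (\<epsilon> * t / 2)"
proof -
  interpret normed_space_over sY by fact
  let ?Q = "\<lambda>z. f z + sY (\<phi> z) (\<epsilon> *\<^sub>R y)"
  have Q: "sup_norm ?Q > sup_norm f - \<epsilon> * t / 2 + \<epsilon>"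
    using norm_le_sup_norm[OF bd(2) x(1)] x y by simp
  have "norm (\<phi> z) > 1 - t" if "z \<in> cball 0 1" "norm (?Q z) > sup_norm ?Q - \<epsilon> * t / 2" for z
  proof -
    have "norm (?Q z) \<le> norm (f z) + norm (\<phi> z) * \<epsilon>"
      using norm_triangle_ineq[of "f z" "sY (\<phi> z) (\<epsilon> *\<^sub>R y)"] y \<open>\<epsilon> > 0\<close> by (simp add: norm_scale)
    with norm_le_sup_norm[OF bd(1) that(1)] that(2) Q
    have "norm (\<phi> z) * \<epsilon> > \<epsilon> - \<epsilon> * t" by linarith
    then have "\<epsilon> * norm (\<phi> z) > \<epsilon> * (1 - t)" by (simp add: algebra_simps)
    then show ?thesis using \<open>\<epsilon> > 0\<close> by simp
  qed
  with cl show ?thesis unfolding near_max_clustered_def peaks_within_def by blast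
qed

text \<open>In hypothesis \<open>bump\<close>, \<open>t\<close> precedes \<open>f\<close> and
  \<open>\<eta>\<close>: the accuracy \<open>e * t / 2\<close> demanded at the peak point can be
  stated only once \<open>t\<close> is known. Closure under whole series, not just finite sums,
  keeps the limit in \<open>F\<close>.\<close>

theorem norm_attaining_dense_by_bumps:
  fixes sY :: "'k::real_or_complex \<Rightarrow> 'b::banach \<Rightarrow> 'b" and F :: "('a::banach \<Rightarrow> 'b) set"
  assumes sY: "normed_space_over sY"
    and bd: "\<And>f. f \<in> F \<Longrightarrow> bounded (f ` cball 0 1)"
    and cont: "\<And>f. f \<in> F \<Longrightarrow> continuous_on (cball 0 1) f"
    and \<Phi>: "\<And>\<phi> z. \<phi> \<in> \<Phi> \<Longrightarrow> z \<in> cball 0 1 \<Longrightarrow> norm (\<phi> z) \<le> 1"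
    and closed: "\<And>f \<phi> v. \<lbrakk>f \<in> F; \<And>k::nat. \<phi> k \<in> \<Phi>; summable (\<lambda>k. norm (v k))\<rbrakk> \<Longrightarrow>
      (\<lambda>z. f z + (\<Sum>k. sY (\<phi> k z) (v k))) \<in> F"
    and bump: "\<And>r. r > 0 \<Longrightarrow> \<exists>t>0. \<forall>f\<in>F. \<forall>\<eta>>0. \<exists>x\<in>cball 0 1. \<exists>\<phi>\<in>\<Phi>.
      norm (f x) > sup_norm f - \<eta> \<and> \<phi> x = 1 \<and> peaks_within F \<phi> t r"
  shows "sup_norm_dense_in {f \<in> F. norm_attaining f} F"
proof (cases "\<exists>v::'b. v \<noteq> 0")
  case False
  then have "norm_attaining f" if "f \<in> F" for f
    by (intro norm_attaining_if_sup_norm_le_0 bounded_image_cballI[where c = 0] sup_norm_le) auto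
  then show ?thesis by (rule sup_norm_dense_in_self)
next
  case True
  interpret normed_space_over sY by fact
  have "\<exists>g\<in>{f \<in> F. norm_attaining f}. sup_norm (\<lambda>x. f x - g x) < \<epsilon>" if f: "f \<in> F" and e: "\<epsilon> > 0" for f \<epsilon>
  proof -
    define P where "P k = (\<lambda>(g, e). g \<in> F \<and> (k = 0 \<longrightarrow> g = f) \<and> 0 < (e::real) \<and> e \<le> \<epsilon> / 4 * (1/2)^k)" for k :: nat
    \<comment> \<open>\<open>e' \<le> e / 2\<close> bounds all bumps from a given stage on by twice
      its first height; \<open>e' \<le> \<eta> / 8\<close> then keeps their total within the
      \<open>\<eta> / 4\<close> under which clustering survives.\<close>
    define R where "R k = (\<lambda>(g, e::real) (g', e'::real) \<phi> y (\<eta>::real). \<phi> \<in> \<Phi> \<and> norm y = 1 \<and> \<eta> > 0 \<and>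
      g' = (\<lambda>z. g z + sY (\<phi> z) (e *\<^sub>R y)) \<and> near_max_clustered F g' ((1/2)^k) \<eta> \<and>
      e' \<le> e / 2 \<and> e' \<le> \<eta> / 8)" for k :: nat
    have "\<exists>s. \<forall>k. P k (s k) \<and> (\<exists>\<phi> y \<eta>. R k (s k) (s (Suc k)) \<phi> y \<eta>)"
    proof (rule dependent_nat_choice)
      have "P 0 (f, \<epsilon> / 4)" using f e by (simp add: P_def)
      then show "\<exists>p. P 0 p" ..
    next
      fix p k assume "P k p"
      then obtain g e where p: "p = (g, e)" and g: "g \<in> F" "0 < e" "e \<le> \<epsilon> / 4 * (1/2)^k"
        by (auto simp: P_def)
      obtain t where t: "t > 0" "\<forall>f\<in>F. \<forall>\<eta>>0. \<exists>x\<in>cball 0 1. \<exists>\<phi>\<in>\<Phi>.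
        norm (f x) > sup_norm f - \<eta> \<and> \<phi> x = 1 \<and> peaks_within F \<phi> t ((1/2)^k)"
        using bump[of "(1/2)^k"] by auto
      have "e * t / 2 > 0" using g t by simp
      with t(2) g(1) obtain x \<phi> where x: "x \<in> cball 0 1" "\<phi> \<in> \<Phi>" "norm (g x) > sup_norm g - e * t / 2"
        "\<phi> x = 1" and c: "peaks_within F \<phi> t ((1/2)^k)"
        by blast
      obtain y where y: "norm y = 1" "\<And>e. e \<ge> 0 \<Longrightarrow> norm (g x + e *\<^sub>R y) = norm (g x) + e"
        using ex_unit_vector_same_direction[OF True] by blast
      define g' where "g' = (\<lambda>z. g z + sY (\<phi> z) (e *\<^sub>R y))"
      \<comment> \<open>A single bump is written as a series with one nonzero term, so that
        \<open>closed\<close> applies.\<close>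
      have "g' = (\<lambda>z. g z + (\<Sum>k. sY (\<phi> z) (if k = 0 then e *\<^sub>R y else 0)))"
        unfolding g'_def by (subst suminf_finite[of "{0}"]) auto
      also have "\<dots> \<in> F"
      proof (rule closed)
        show "summable (\<lambda>k::nat. norm (if k = 0 then e *\<^sub>R y else 0))"
          by (rule summable_finite[of "{0}"]) auto
      qed (use g x in auto)
      finally have g': "g' \<in> F" .
      have cl: "near_max_clustered F g' ((1/2)^k) (e * t / 2)"
        unfolding g'_def
      proof (rule near_max_clustered_bump[OF sY])
        show "bounded ((\<lambda>z. g z + sY (\<phi> z) (e *\<^sub>R y)) ` cball 0 1)"
          using bd[OF g'] by (simp add: g'_def)
      qed (use g t x y c bd in auto)
      define e' where "e' = min (e / 2) (e * t / 2 / 8)"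
      have "e / 2 \<le> \<epsilon> / 4 * (1/2)^Suc k" using g by simp
      then have "P (Suc k) (g', e') \<and> R k p (g', e') \<phi> y (e * t / 2)"
        using g t g' x y cl unfolding P_def R_def p by (auto simp: e'_def g'_def)
      then show "\<exists>q. P (Suc k) q \<and> (\<exists>\<phi> y \<eta>. R k p q \<phi> y \<eta>)" by blast
    qed
    then obtain s where s': "\<forall>k. P k (s k) \<and> (\<exists>\<phi> y \<eta>. R k (s k) (s (Suc k)) \<phi> y \<eta>)" ..
    then have s: "P k (s k)" "\<exists>\<phi> y \<eta>. R k (s k) (s (Suc k)) \<phi> y \<eta>" for k
      by blast+
    from s(2) obtain \<phi> y \<eta> where R: "\<And>k. R k (s k) (s (Suc k)) (\<phi> k) (y k) (\<eta> k)"
      by metis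
    define g where "g k = fst (s k)" for k
    define e where "e k = snd (s k)" for k
    have g: "g k \<in> F" "0 < e k" "e k \<le> \<epsilon> / 4 * (1/2)^k" "g 0 = f" for k
      using s(1)[of k] s(1)[of 0] by (auto simp: P_def g_def e_def split: prod.splits)
    have R: "\<phi> k \<in> \<Phi>" "norm (y k) = 1" "\<eta> k > 0"
      "g (Suc k) z = g k z + sY (\<phi> k z) (e k *\<^sub>R y k)"
      "near_max_clustered F (g (Suc k)) ((1/2)^k) (\<eta> k)"
      "e (Suc k) \<le> e k / 2" "e (Suc k) \<le> \<eta> k / 8" for k z
      using R[of k] by (auto simp: R_def g_def e_def split: prod.splits)
    define v where "v k = e k *\<^sub>R y k" for k
    have nv: "norm (v k) = e k" for k
      using g(2)[of k] R(2)[of k] by (simp add: v_def)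
    have e_geo: "e (j + K) \<le> e K * (1/2)^j" for j K
    proof (induction j)
      case (Suc j)
      with R(6)[of "j + K"] show ?case by simp
    qed simp
    have sum_e: "summable (\<lambda>k. e k)"
      by (rule summable_comparison_test'[where g = "\<lambda>k. e 0 * (1/2)^k"])
        (use e_geo[of _ 0] g(2) in \<open>auto simp: less_imp_le\<close>)
    define h where "h z = f z + (\<Sum>k. sY (\<phi> k z) (v k))" for z
    have h: "h \<in> F"
      unfolding h_def by (rule closed) (use f R(1) sum_e nv in auto)
    have gs: "g K z = f z + (\<Sum>k<K. sY (\<phi> k z) (v k))" for K z
      by (induction K) (simp_all add: g R(4) v_def)
    have tail: "norm (h z - g K z) \<le> 2 * e K" if z: "z \<in> cball 0 1" for z K
    proof -
      have n: "norm (sY (\<phi> k z) (v k)) \<le> e k" for k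
        using mult_right_mono[OF \<Phi>[OF R(1)[of k] z], of "e k"] g(2)[of k]
        by (simp add: norm_scale nv)
      have s: "summable (\<lambda>k. sY (\<phi> k z) (v k))"
        by (rule summable_comparison_test'[OF sum_e]) (use n in auto)
      have "h z - g K z = (\<Sum>k. sY (\<phi> (k + K) z) (v (k + K)))"
        using suminf_minus_initial_segment[OF s, of K] by (simp add: h_def gs)
      also have "norm \<dots> \<le> (\<Sum>k. e K * (1/2)^k)"
        by (rule norm_suminf_le) (use n e_geo[of _ K] order_trans in \<open>blast, auto\<close>)
      also have "\<dots> = 2 * e K"
        by (subst suminf_mult) (auto simp: suminf_geometric)
      finally show ?thesis .
    qed
    have "norm_attaining h"
    proof (rule norm_attaining_if_clustered[OF h bd[OF h] cont[OF h]])
      fix r :: real assume "r > 0"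
      then obtain k where k: "(1/2)^k < r" using real_arch_pow_inv[of r "1/2"] by auto
      have "norm (h z - g (Suc k) z) \<le> \<eta> k / 4" if "z \<in> cball 0 1" for z
        using tail[OF that, of "Suc k"] R(7)[of k] by linarith
      from near_max_clustered_perturb[OF R(5)[of k] bd[OF h] this]
      have "near_max_clustered F h r (\<eta> k / 4)"
        using k unfolding near_max_clustered_def by (meson less_trans)
      with R(3)[of k] show "\<exists>\<eta>>0. near_max_clustered F h r \<eta>"
        by (intro exI[of _ "\<eta> k / 4"]) simp
    qed
    moreover have "sup_norm (\<lambda>x. f x - h x) < \<epsilon>"
    proof -
      have "sup_norm (\<lambda>x. f x - h x) \<le> 2 * e 0"
        by (rule sup_norm_le) (use tail[of _ 0] g(4) in \<open>simp add: norm_minus_commute\<close>)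
      also have "\<dots> < \<epsilon>" using g(3)[of 0] e by simp
      finally show ?thesis .
    qed
    ultimately show ?thesis using h by blast
  qed
  then show ?thesis unfolding sup_norm_dense_in_def by blast
qed

section \<open>Homogeneous polynomials\<close>

text \<open>The class does not state that decompositions are unique. When \<open>imag_unit\<close>
  is nonzero, squaring gives \<open>(r - a)\<^sup>2 = - b\<^sup>2\<close> between reals, and both
  sides must vanish.\<close>

lemma re_part_of_real [simp]: "re_part (of_real r :: 'k::real_or_complex) = r"
proof -
  define a where "a = re_part (of_real r :: 'k)"
  define b where "b = im_part (of_real r :: 'k)"
  have d: "(of_real r :: 'k) = of_real a + b *\<^sub>R imag_unit"
    using re_im_decomp[of "of_real r :: 'k"] by (simp add: a_def b_def scaleR_conv_of_real)
  show ?thesis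
  proof (cases "(imag_unit :: 'k) = 0")
    case True
    with d show ?thesis by (simp add: a_def)
  next
    case False
    then have i: "(imag_unit :: 'k) * imag_unit = - 1" using imag_unit_cases by blast
    have "of_real ((r - a)\<^sup>2) = (b *\<^sub>R (imag_unit :: 'k)) * (b *\<^sub>R imag_unit)"
      using d by (simp add: power2_eq_square)
    also have "\<dots> = of_real (- b\<^sup>2)"
      by (simp only: mult_scaleR_left mult_scaleR_right i) (simp add: power2_eq_square scaleR_conv_of_real)
    finally have "(r - a)\<^sup>2 = - b\<^sup>2" by (simp only: of_real_eq_iff)
    then have "(r - a)\<^sup>2 = 0"
      using zero_le_power2[of "r - a"] zero_le_power2[of b] by linarith
    then show ?thesis by (simp add: a_def)
  qed
qed

section \<open>Functionals, multilinear maps and homogeneity\<close>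

lemma dual_space_norm_le:
  assumes "\<phi> \<in> dual_space s" "onorm \<phi> \<le> 1"
  shows "norm (\<phi> x) \<le> norm x"
proof -
  have "norm (\<phi> x) \<le> onorm \<phi> * norm x"
    using assms(1) by (intro onorm) (simp add: dual_space_def)
  also have "\<dots> \<le> norm x" using mult_right_mono[OF assms(2), of "norm x"] by simp
  finally show ?thesis .
qed

lemma dual_space_norm_le_1:
  assumes "\<phi> \<in> dual_space s" "onorm \<phi> \<le> 1" "x \<in> cball 0 1"
  shows "norm (\<phi> x) \<le> 1"
  using dual_space_norm_le[OF assms(1,2), of x] assms(3) by simp

lemma dual_space_add: "\<phi> \<in> dual_space s \<Longrightarrow> \<phi> (x + y) = \<phi> x + \<phi> y"
  by (simp add: dual_space_def Vector_Spaces.linear_iff)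

lemma dual_space_scale: "\<phi> \<in> dual_space s \<Longrightarrow> \<phi> (s c x) = c * \<phi> x"
  by (simp add: dual_space_def Vector_Spaces.linear_iff)

lemma multilinear_linear_at:
  assumes "multilinear sX sY n L" "length us + length vs + 1 = n"
  shows "Vector_Spaces.linear sX sY (\<lambda>x. L (us @ x # vs))"
proof -
  have "length (us @ 0 # vs) = n" "length us < n" using assms(2) by auto
  with assms(1) have "Vector_Spaces.linear sX sY (\<lambda>x. L ((us @ 0 # vs)[length us := x]))"
    unfolding multilinear_def by blast
  then show ?thesis by (simp add: list_update_length)
qed

lemma replicate_Suc_append: "replicate (Suc k) a @ ys = replicate k a @ a # ys"
  by (simp add: replicate_app_Cons_same)

text \<open>Slots are treated from the right end of the block; \<open>ys\<close> collects those
  already done, which is why the induction generalizes over it.\<close>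

lemma multilinear_replicate_scale:
  assumes L: "multilinear sX sY n L" and sY: "normed_space_over sY" and "k + length ys = n"
  shows "L (replicate k (sX c x) @ ys) = sY (c ^ k) (L (replicate k x @ ys))"
  using assms(3)
proof (induction k arbitrary: ys)
  case 0
  interpret normed_space_over sY by fact
  show ?case by simp
next
  case (Suc k)
  interpret normed_space_over sY by fact
  have "L (replicate (Suc k) (sX c x) @ ys) = sY (c ^ k) (L (replicate k x @ sX c x # ys))"
    unfolding replicate_Suc_append by (rule Suc.IH) (use Suc.prems in simp)
  also have "L (replicate k x @ sX c x # ys) = sY c (L (replicate k x @ x # ys))"
    using multilinear_linear_at[OF L, of "replicate k x" ys] Suc.prems
    by (simp add: Vector_Spaces.linear_iff)
  finally show ?case unfolding replicate_Suc_append by (simp add: mult.commute)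
qed

lemma hom_poly_scale:
  assumes "P \<in> bounded_hom_polys sX sY n" "normed_space_over sY"
  shows "P (sX c x) = sY (c ^ n) (P x)"
proof -
  obtain L where "multilinear sX sY n L" "\<And>x. P x = L (replicate n x)"
    using assms(1) by (auto simp: bounded_hom_polys_def)
  then show ?thesis using multilinear_replicate_scale[of sX sY n L n "[]"] assms(2) by simp
qed

lemma hom_poly_scaleR:
  assumes "P \<in> bounded_hom_polys sX sY n" "normed_space_over sX" "normed_space_over sY"
  shows "P (r *\<^sub>R x) = r ^ n *\<^sub>R P x"
  using hom_poly_scale[OF assms(1,3), of "of_real r" x]
  by (simp add: normed_space_over.scale_of_real[OF assms(2)]
      normed_space_over.scale_of_real[OF assms(3)] of_real_power[symmetric] del: of_real_power)

lemma hom_poly_zero: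
  assumes "P \<in> bounded_hom_polys sX sY n" "normed_space_over sX" "normed_space_over sY" "n \<ge> 1"
  shows "P 0 = 0"
  using hom_poly_scaleR[OF assms(1-3), of 0 0] assms(4) by (simp add: power_0_left)

section \<open>Continuity of bounded homogeneous polynomials\<close>

lemma hom_poly_along_line:
  assumes P: "P \<in> bounded_hom_polys sX sY n" and sX: "normed_space_over sX" and sY: "normed_space_over sY"
  shows "\<exists>q. \<forall>t::real. P (x + t *\<^sub>R h) = (\<Sum>m\<le>n. t ^ m *\<^sub>R q m)"
proof -
  obtain L where L: "multilinear sX sY n L" and PL: "\<And>x. P x = L (replicate n x)"
    using P by (auto simp: bounded_hom_polys_def)
  have lin: "L (us @ (x + t *\<^sub>R h) # vs) = L (us @ x # vs) + t *\<^sub>R L (us @ h # vs)"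
    if "length us + length vs + 1 = n" for us vs and t :: real
  proof -
    have "t *\<^sub>R h = sX (of_real t) h" by (simp add: normed_space_over.scale_of_real[OF sX])
    then show ?thesis
      using multilinear_linear_at[OF L that] normed_space_over.scale_of_real[OF sY]
      by (simp add: Vector_Spaces.linear_iff)
  qed
  have "\<exists>q. \<forall>t::real. L (replicate k (x + t *\<^sub>R h) @ ys) = (\<Sum>m\<le>k. t ^ m *\<^sub>R q m)"
    if "k + length ys = n" for k ys
    using that
  proof (induction k arbitrary: ys)
    case 0
    show ?case by (intro exI[of _ "\<lambda>_. L ys"]) simp
  next
    case (Suc k)
    obtain q where q: "\<And>t::real. L (replicate k (x + t *\<^sub>R h) @ x # ys) = (\<Sum>m\<le>k. t ^ m *\<^sub>R q m)"
      using Suc.IH[of "x # ys"] Suc.prems by auto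
    obtain q' where q': "\<And>t::real. L (replicate k (x + t *\<^sub>R h) @ h # ys) = (\<Sum>m\<le>k. t ^ m *\<^sub>R q' m)"
      using Suc.IH[of "h # ys"] Suc.prems by auto
    \<comment> \<open>Linearity in the last slot of the block splits the value in two:
      \<open>x\<close> there keeps the degree, while \<open>h\<close> there comes with a factor
      \<open>t\<close>, which shifts the coefficients \<open>q'\<close> by one.\<close>
    define p where "p m = (if m \<le> k then q m else 0) + (if m = 0 then 0 else q' (m - 1))" for m
    have "L (replicate (Suc k) (x + t *\<^sub>R h) @ ys) = (\<Sum>m\<le>Suc k. t ^ m *\<^sub>R p m)" for t :: real
    proof -
      have "(\<Sum>m\<le>Suc k. t ^ m *\<^sub>R p m) = (\<Sum>m\<le>Suc k. t ^ m *\<^sub>R (if m \<le> k then q m else 0))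
          + (\<Sum>m\<le>Suc k. t ^ m *\<^sub>R (if m = 0 then 0 else q' (m - 1)))"
        by (simp only: p_def scaleR_right_distrib sum.distrib)
      also have "(\<Sum>m\<le>Suc k. t ^ m *\<^sub>R (if m \<le> k then q m else 0)) = (\<Sum>m\<le>k. t ^ m *\<^sub>R q m)"
        by simp
      also have "(\<Sum>m\<le>Suc k. t ^ m *\<^sub>R (if m = 0 then 0 else q' (m - 1))) = (\<Sum>m\<le>k. t ^ Suc m *\<^sub>R q' m)"
        by (subst sum.atMost_Suc_shift) simp
      also have "\<dots> = t *\<^sub>R (\<Sum>m\<le>k. t ^ m *\<^sub>R q' m)"
        by (simp add: scaleR_right.sum)
      finally show ?thesis
        unfolding replicate_Suc_append using Suc.prems by (subst lin) (simp_all add: q q')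
    qed
    then show ?case by blast
  qed
  from this[of n "[]"] show ?thesis by (simp add: PL)
qed

text \<open>Passing from \<open>p(t)\<close> to \<open>p(t) - 2\<^sup>n p(t/2)\<close> removes the leading term.\<close>

lemma poly_coeffs_bounded:
  "\<exists>C\<ge>0. \<forall>(q :: nat \<Rightarrow> 'b::real_normed_vector) M.
    (\<forall>t\<in>{0..1}. norm (\<Sum>m\<le>n. t ^ m *\<^sub>R q m) \<le> M) \<longrightarrow> (\<forall>m\<le>n. norm (q m) \<le> C * M)"
proof (induction n)
  case 0
  show ?case by (intro exI[of _ 1]) auto
next
  case (Suc n)
  then obtain C where C: "C \<ge> 0" "\<And>(q :: nat \<Rightarrow> 'b) M m.
    \<lbrakk>\<And>t. t \<in> {0..1} \<Longrightarrow> norm (\<Sum>m\<le>n. t ^ m *\<^sub>R q m) \<le> M; m \<le> n\<rbrakk> \<Longrightarrow> norm (q m) \<le> C * M"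
    by meson
  define D where "D = C * (1 + 2 ^ Suc n)"
  have D: "D \<ge> 0" using C by (simp add: D_def)
  have *: "norm (q m) \<le> (1 + D + (\<Sum>m\<le>n. D)) * M"
    if q: "\<forall>t\<in>{0..1}. norm (\<Sum>m\<le>Suc n. t ^ m *\<^sub>R q m) \<le> M" and "m \<le> Suc n" for q :: "nat \<Rightarrow> 'b" and M m
  proof -
    have M: "M \<ge> 0" using q[rule_format, of 0] order_trans[OF norm_ge_zero] by (metis atLeastAtMost_iff order_refl zero_le_one)
    \<comment> \<open>The factor vanishes at \<open>m = Suc n\<close> and has modulus at least 1 for
      smaller \<open>m\<close>, so a bound on \<open>r m\<close> is one on
      \<open>q m\<close>.\<close>
    define r where "r m = (1 - 2 ^ (Suc n - m)) *\<^sub>R q m" for m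
    have r: "norm (\<Sum>m\<le>n. t ^ m *\<^sub>R r m) \<le> (1 + 2 ^ Suc n) * M" if t: "t \<in> {0..1}" for t
    proof -
      have "t ^ m *\<^sub>R r m = t ^ m *\<^sub>R q m - 2 ^ Suc n *\<^sub>R ((t / 2) ^ m *\<^sub>R q m)" if "m \<le> Suc n" for m
      proof -
        have "(2::real) ^ Suc n = 2 ^ (Suc n - m) * 2 ^ m"
          using that by (simp flip: power_add)
        then have "2 ^ Suc n * (t / 2) ^ m = t ^ m * 2 ^ (Suc n - m)"
          by (simp add: power_divide)
        then show ?thesis by (simp add: r_def algebra_simps)
      qed
      then have "(\<Sum>m\<le>Suc n. t ^ m *\<^sub>R r m) =
          (\<Sum>m\<le>Suc n. t ^ m *\<^sub>R q m) - 2 ^ Suc n *\<^sub>R (\<Sum>m\<le>Suc n. (t / 2) ^ m *\<^sub>R q m)"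
        unfolding scaleR_right.sum sum_subtractf[symmetric] by (intro sum.cong) auto
      moreover have "(\<Sum>m\<le>Suc n. t ^ m *\<^sub>R r m) = (\<Sum>m\<le>n. t ^ m *\<^sub>R r m)"
        by (simp add: r_def)
      ultimately have "norm (\<Sum>m\<le>n. t ^ m *\<^sub>R r m) \<le> norm (\<Sum>m\<le>Suc n. t ^ m *\<^sub>R q m)
          + 2 ^ Suc n * norm (\<Sum>m\<le>Suc n. (t / 2) ^ m *\<^sub>R q m)"
        using norm_triangle_ineq4[of "\<Sum>m\<le>Suc n. t ^ m *\<^sub>R q m" "2 ^ Suc n *\<^sub>R (\<Sum>m\<le>Suc n. (t / 2) ^ m *\<^sub>R q m)"]
        by (simp del: sum.atMost_Suc)
      also have "\<dots> \<le> M + 2 ^ Suc n * M"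
        using q t by (intro add_mono mult_left_mono) (auto simp del: sum.atMost_Suc)
      finally show ?thesis by (simp add: algebra_simps)
    qed
    have le: "norm (q m) \<le> D * M" if "m \<le> n" for m
    proof -
      have "(2::real) ^ 1 \<le> 2 ^ (Suc n - m)" using that by (intro power_increasing) auto
      then have "1 * norm (q m) \<le> \<bar>1 - 2 ^ (Suc n - m)\<bar> * norm (q m)"
        by (intro mult_right_mono) auto
      also have "\<dots> = norm (r m)" by (simp add: r_def)
      also have "\<dots> \<le> C * ((1 + 2 ^ Suc n) * M)" using C(2)[of r, OF r that] .
      finally show ?thesis by (simp add: D_def mult.assoc)
    qed
    show ?thesis
    proof (cases "m \<le> n")
      case True
      have "D * M \<le> (1 + D + (\<Sum>m\<le>n. D)) * M" using D M by (intro mult_right_mono) auto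
      with le[OF True] show ?thesis by linarith
    next
      case False
      then have m: "m = Suc n" using that by simp
      \<comment> \<open>The value at \<open>t = 1\<close> is the sum of all coefficients, which
        isolates the leading one.\<close>
      have "q (Suc n) = (\<Sum>m\<le>Suc n. q m) - (\<Sum>m\<le>n. q m)" by simp
      also have "norm \<dots> \<le> norm (\<Sum>m\<le>Suc n. q m) + norm (\<Sum>m\<le>n. q m)"
        by (rule norm_triangle_ineq4)
      also have "\<dots> \<le> M + (\<Sum>m\<le>n. D * M)"
        using q[rule_format, of 1] le by (intro add_mono sum_norm_le) (auto simp del: sum.atMost_Suc)
      also have "\<dots> \<le> (1 + D + (\<Sum>m\<le>n. D)) * M"
        using D M by (simp add: algebra_simps)
      finally show ?thesis by (simp add: m)
    qed
  qed
  have "0 \<le> 1 + D + (\<Sum>m\<le>n. D)" using D by simp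
  with * show ?case by blast
qed

text \<open>A bound is given for \<open>P\<close> on the ball but none for the multilinear map, so
  continuity is obtained along lines. On a unit segment starting in the ball \<open>P\<close> is at
  most \<open>2 ^ n * B\<close>; this bounds the coefficients of the one-variable polynomial
  independently of the line, and gives a Lipschitz estimate at distances up to 1.\<close>

lemma continuous_on_hom_poly:
  fixes P :: "'a::real_normed_vector \<Rightarrow> 'b::real_normed_vector"
  assumes P: "P \<in> bounded_hom_polys sX sY n" and sX: "normed_space_over sX" and sY: "normed_space_over sY"
  shows "continuous_on (cball 0 1) P"
proof -
  obtain B where B: "\<And>x. x \<in> cball 0 1 \<Longrightarrow> norm (P x) \<le> B"
  proof -
    have "bounded (P ` cball 0 1)" using P by (simp add: bounded_hom_polys_def)
    with that show ?thesis unfolding bounded_iff by blast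
  qed
  have B2: "norm (P u) \<le> 2 ^ n * B" if "norm u \<le> 2" for u
  proof -
    have "norm (P (2 *\<^sub>R ((1/2) *\<^sub>R u))) = 2 ^ n * norm (P ((1/2) *\<^sub>R u))"
      by (subst hom_poly_scaleR[OF P sX sY]) simp
    then show ?thesis using B[of "(1/2) *\<^sub>R u"] that by simp
  qed
  obtain C where C: "C \<ge> 0" "\<And>(q :: nat \<Rightarrow> 'b) M m.
    \<lbrakk>\<And>t. t \<in> {0..1} \<Longrightarrow> norm (\<Sum>m\<le>n. t ^ m *\<^sub>R q m) \<le> M; m \<le> n\<rbrakk> \<Longrightarrow> norm (q m) \<le> C * M"
    using poly_coeffs_bounded[of n, where 'b = 'b] by meson
  define K where "K = real n * (C * (2 ^ n * B))"
  have K: "norm (P z - P x) \<le> K * norm (z - x)" if x: "x \<in> cball 0 1" and z: "norm (z - x) \<le> 1" for x z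
  proof -
    define s where "s = norm (z - x)"
    obtain q where q: "\<And>t::real. P (x + t *\<^sub>R sgn (z - x)) = (\<Sum>m\<le>n. t ^ m *\<^sub>R q m)"
      using hom_poly_along_line[OF P sX sY] by blast
    have "norm (\<Sum>m\<le>n. t ^ m *\<^sub>R q m) \<le> 2 ^ n * B" if "t \<in> {0..1}" for t
    proof -
      have "norm (x + t *\<^sub>R sgn (z - x)) \<le> norm x + \<bar>t\<bar> * norm (sgn (z - x))"
        using norm_triangle_ineq[of x "t *\<^sub>R sgn (z - x)"] by simp
      also have "\<dots> \<le> 1 + 1 * 1"
        using that x by (intro add_mono mult_mono) (auto simp: norm_sgn)
      finally show ?thesis using B2 by (simp flip: q)
    qed
    from C(2)[of q, OF this] have qb: "norm (q m) \<le> C * (2 ^ n * B)" if "m \<le> n" for m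
      using that by blast
    have "x + s *\<^sub>R sgn (z - x) = z" by (cases "z = x") (simp_all add: s_def sgn_div_norm)
    \<comment> \<open>The constant terms cancel; every remaining power of \<open>s\<close> is at
      most \<open>s\<close>, since \<open>s \<le> 1\<close>.\<close>
    then have "P z - P x = (\<Sum>m\<le>n. s ^ m *\<^sub>R q m) - (\<Sum>m\<le>n. 0 ^ m *\<^sub>R q m)"
      using q[of s] q[of 0] by simp
    also have "\<dots> = (\<Sum>m<n. s ^ Suc m *\<^sub>R q (Suc m))"
      by (subst (1 2) lessThan_Suc_atMost[symmetric]) (simp only: sum.lessThan_Suc_shift, simp)
    also have "norm \<dots> \<le> (\<Sum>m<n. s * (C * (2 ^ n * B)))"
    proof (rule sum_norm_le)
      fix m assume m: "m \<in> {..<n}"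
      have "s ^ Suc m \<le> s" using z power_le_one[of s m] mult_left_mono[of "s ^ m" 1 s] by (simp add: s_def)
      then show "norm (s ^ Suc m *\<^sub>R q (Suc m)) \<le> s * (C * (2 ^ n * B))"
        using qb[of "Suc m"] m by (simp only: norm_scaleR) (intro mult_mono, auto simp: s_def)
    qed
    finally show ?thesis by (simp add: K_def s_def mult_ac)
  qed
  show ?thesis
    unfolding continuous_on_iff
  proof (intro ballI allI impI)
    fix x :: 'a and e :: real assume x: "x \<in> cball 0 1" and e: "e > 0"
    define d where "d = min 1 (e / (\<bar>K\<bar> + 1))"
    have d: "d > 0" using e by (simp add: d_def)
    have "dist (P z) (P x) < e" if "dist z x < d" for z
    proof -
      have n1: "norm (z - x) \<le> 1" and n2: "norm (z - x) < e / (\<bar>K\<bar> + 1)"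
        using that by (auto simp: d_def dist_norm)
      have "norm (P z - P x) \<le> K * norm (z - x)" by (rule K[OF x n1])
      also have "\<dots> \<le> (\<bar>K\<bar> + 1) * norm (z - x)" by (intro mult_right_mono) auto
      also have "\<dots> < e" using n2 by (simp add: pos_less_divide_eq mult.commute)
      finally show ?thesis by (simp add: dist_norm)
    qed
    with d show "\<exists>d>0. \<forall>z\<in>cball 0 1. dist z x < d \<longrightarrow> dist (P z) (P x) < e" by blast
  qed
qed

section \<open>Series of powers of functionals\<close>

lemma summable_scale_bounded:
  fixes v :: "nat \<Rightarrow> 'b::banach"
  assumes "normed_space_over sY" "summable (\<lambda>k. norm (v k))" "\<And>k. norm (c k) \<le> D"
  shows "summable (\<lambda>k. norm (sY (c k) (v k)))" "summable (\<lambda>k. sY (c k) (v k))"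
proof -
  have "norm (sY (c k) (v k)) \<le> D * norm (v k)" for k
    using mult_right_mono[OF assms(3)[of k], of "norm (v k)"]
    by (simp add: normed_space_over.norm_scale[OF assms(1)])
  then show "summable (\<lambda>k. norm (sY (c k) (v k)))"
    by (intro summable_comparison_test'[OF summable_mult[OF assms(2), of D]]) auto
  then show "summable (\<lambda>k. sY (c k) (v k))" by (rule summable_norm_cancel)
qed

lemma linear_suminf_functionals:
  fixes sY :: "'k::real_or_complex \<Rightarrow> 'b::banach \<Rightarrow> 'b" and \<phi> :: "nat \<Rightarrow> 'a::real_normed_vector \<Rightarrow> 'k"
  assumes sX: "normed_space_over sX" and sY: "normed_space_over sY"
    and \<phi>: "\<And>k. \<phi> k \<in> dual_space sX" "\<And>k. onorm (\<phi> k) \<le> 1" and v: "summable (\<lambda>k. norm (v k))"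
  shows "Vector_Spaces.linear sX sY (\<lambda>x. \<Sum>k. sY (\<phi> k x) (v k))"
proof -
  interpret X: normed_space_over sX by fact
  interpret Y: normed_space_over sY by fact
  have s: "summable (\<lambda>k. sY (\<phi> k x) (v k))" for x
    by (rule summable_scale_bounded[OF sY v]) (rule dual_space_norm_le[OF \<phi>])
  show ?thesis
    unfolding Vector_Spaces.linear_iff
  proof (intro conjI allI)
    fix x y
    show "(\<Sum>k. sY (\<phi> k (x + y)) (v k)) = (\<Sum>k. sY (\<phi> k x) (v k)) + (\<Sum>k. sY (\<phi> k y) (v k))"
      by (simp add: suminf_add[OF s s] dual_space_add[OF \<phi>(1)] Y.scale_left_distrib)
  next
    fix c x
    show "(\<Sum>k. sY (\<phi> k (sX c x)) (v k)) = sY c (\<Sum>k. sY (\<phi> k x) (v k))"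
      by (simp add: bounded_linear.suminf[OF Y.bounded_linear_scale_right s] dual_space_scale[OF \<phi>(1)])
  qed (unfold_locales)
qed

text \<open>The arguments outside slot \<open>i\<close> enter through products bounded uniformly in
  \<open>k\<close>, so they can be absorbed into the summable vectors, and linearity in slot
  \<open>i\<close> is that of a series of functionals. The result serves both the polynomial bumps
  and the Taylor terms of the analytic ones.\<close>

lemma suminf_powers_hom_poly:
  fixes sY :: "'k::real_or_complex \<Rightarrow> 'b::banach \<Rightarrow> 'b" and \<phi> :: "nat \<Rightarrow> 'a::real_normed_vector \<Rightarrow> 'k"
  assumes sX: "normed_space_over sX" and sY: "normed_space_over sY"
    and \<phi>: "\<And>k. \<phi> k \<in> dual_space sX" "\<And>k. onorm (\<phi> k) \<le> 1" and v: "summable (\<lambda>k. norm (v k))"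
  shows "(\<lambda>x. \<Sum>k. sY (\<phi> k x ^ n) (v k)) \<in> bounded_hom_polys sX sY n"
proof -
  interpret Y: normed_space_over sY by fact
  define L where "L xs = (\<Sum>k. sY (\<Prod>i<n. \<phi> k (xs ! i)) (v k))" for xs
  have "multilinear sX sY n L"
    unfolding multilinear_def
  proof (intro allI impI)
    fix xs :: "'a list" and i assume xs: "length xs = n" and i: "i < n"
    define c where "c k = (\<Prod>j\<in>{..<n} - {i}. \<phi> k (xs ! j))" for k
    have "norm (c k) \<le> (\<Prod>j\<in>{..<n} - {i}. norm (xs ! j))" for k
      unfolding c_def prod_norm[symmetric] by (intro prod_mono) (auto simp: dual_space_norm_le[OF \<phi>])
    then have s: "summable (\<lambda>k. norm (sY (c k) (v k)))"
      by (rule summable_scale_bounded[OF sY v])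
    have "(\<Prod>j<n. \<phi> k (xs[i := x] ! j)) = \<phi> k x * c k" for k x
    proof -
      have "(\<Prod>j<n. \<phi> k (xs[i := x] ! j)) = \<phi> k (xs[i := x] ! i) * (\<Prod>j\<in>{..<n} - {i}. \<phi> k (xs[i := x] ! j))"
        using i by (intro prod.remove) auto
      also have "(\<Prod>j\<in>{..<n} - {i}. \<phi> k (xs[i := x] ! j)) = c k"
        unfolding c_def by (intro prod.cong) auto
      finally show ?thesis using i xs by simp
    qed
    then have "L (xs[i := x]) = (\<Sum>k. sY (\<phi> k x) (sY (c k) (v k)))" for x
      by (simp add: L_def)
    with linear_suminf_functionals[OF sX sY \<phi> s]
    show "Vector_Spaces.linear sX sY (\<lambda>x. L (xs[i := x]))" by simp
  qed
  moreover have "(\<Sum>k. sY (\<phi> k x ^ n) (v k)) = L (replicate n x)" for x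
    by (simp add: L_def)
  moreover have "norm (\<Sum>k. sY (\<phi> k x ^ n) (v k)) \<le> (\<Sum>k. norm (v k))" if "x \<in> cball 0 1" for x
  proof (rule norm_suminf_le[OF _ v])
    show "norm (sY (\<phi> k x ^ n) (v k)) \<le> norm (v k)" for k
      using mult_right_mono[OF power_le_one[OF norm_ge_zero dual_space_norm_le_1[OF \<phi> that]], of "norm (v k)" k n]
      by (simp add: Y.norm_scale norm_power)
  qed
  ultimately show ?thesis
    unfolding bounded_hom_polys_def by (blast intro: bounded_image_cballI)
qed

lemma hom_poly_add:
  assumes "P \<in> bounded_hom_polys sX sY n" "Q \<in> bounded_hom_polys sX sY n" "normed_space_over sY"
  shows "(\<lambda>x. P x + Q x) \<in> bounded_hom_polys sX sY n"
proof -
  interpret normed_space_over sY by fact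
  obtain L where L: "multilinear sX sY n L" "\<And>x. P x = L (replicate n x)" "bounded (P ` cball 0 1)"
    using assms(1) by (auto simp: bounded_hom_polys_def)
  obtain M where M: "multilinear sX sY n M" "\<And>x. Q x = M (replicate n x)" "bounded (Q ` cball 0 1)"
    using assms(2) by (auto simp: bounded_hom_polys_def)
  have "multilinear sX sY n (\<lambda>xs. L xs + M xs)"
    using L(1) M(1) unfolding multilinear_def
    by (auto simp: Vector_Spaces.linear_iff scale_right_distrib)
  moreover have "bounded ((\<lambda>x. P x + Q x) ` cball 0 1)"
    using bounded_plus_comp[OF L(3) M(3)] .
  ultimately show ?thesis using L(2) M(2) unfolding bounded_hom_polys_def by auto
qed

text \<open>A unimodular factor turns \<open>\<phi> z\<close> into the positive real
  \<open>norm (\<phi> z)\<close>, to which the exposure estimate applies. Both rotated points then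
  lie within \<open>r / 3\<close> of \<open>a\<close>; undoing the first rotation, an isometry,
  takes the second rotated point to \<open>z''\<close>. Such factors leave the norm of a homogeneous
  polynomial unchanged.\<close>

lemma peaks_within_rotation:
  fixes sX :: "'k::real_or_complex \<Rightarrow> 'a::real_normed_vector \<Rightarrow> 'a"
  assumes sX: "normed_space_over sX" and sY: "normed_space_over sY" and n: "n \<ge> 1"
    and \<phi>: "\<phi> \<in> dual_space sX" "onorm \<phi> \<le> 1" and t: "0 < t" "t < 1" and "r > 0"
    and exp: "\<And>z. \<lbrakk>z \<in> cball 0 1; re_part (\<phi> z) \<ge> 1 - t\<rbrakk> \<Longrightarrow> norm (z - a) \<le> r / 3"
  shows "peaks_within (bounded_hom_polys sX sY n) (\<lambda>z. \<phi> z ^ n) t r"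
proof -
  interpret X: normed_space_over sX by fact
  interpret Y: normed_space_over sY by fact
  have rot: "\<exists>c. norm c = 1 \<and> norm (sX c z - a) \<le> r / 3" if z: "z \<in> cball 0 1" and p: "norm (\<phi> z ^ n) > 1 - t" for z
  proof -
    have "norm (\<phi> z) ^ n \<le> norm (\<phi> z) ^ 1"
      using n dual_space_norm_le_1[OF \<phi> z] by (intro power_decreasing) auto
    then have p1: "norm (\<phi> z) > 1 - t" using p by (simp add: norm_power)
    then have nz: "\<phi> z \<noteq> 0" using t by auto
    define c where "c = of_real (norm (\<phi> z)) / \<phi> z"
    have c: "norm c = 1" using nz by (simp add: c_def norm_divide)
    have "\<phi> (sX c z) = of_real (norm (\<phi> z))" using nz by (simp add: dual_space_scale[OF \<phi>(1)] c_def)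
    then have "norm (sX c z - a) \<le> r / 3"
      using p1 z c by (intro exp) (auto simp: X.norm_scale)
    with c show ?thesis by blast
  qed
  show ?thesis
    unfolding peaks_within_def
  proof (intro ballI impI)
    fix z z' assume z: "z \<in> cball 0 1" "z' \<in> cball 0 1"
      and p: "1 - t < norm (\<phi> z ^ n) \<and> 1 - t < norm (\<phi> z' ^ n)"
    obtain c where c: "norm c = 1" "norm (sX c z - a) \<le> r / 3" using rot z p by blast
    obtain c' where c': "norm c' = 1" "norm (sX c' z' - a) \<le> r / 3" using rot z p by blast
    define z'' where "z'' = sX (c' / c) z'"
    have c0: "c \<noteq> 0" using c by auto
    have "norm (z'' - z) = norm (sX c (z'' - z))" using c by (simp add: X.norm_scale)
    also have "sX c (z'' - z) = (sX c' z' - a) - (sX c z - a)"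
      using c0 by (simp add: z''_def X.scale_right_diff_distrib)
    also have "norm \<dots> \<le> r / 3 + r / 3"
      using norm_triangle_ineq4 c(2) c'(2) by (meson add_mono order_trans)
    also have "\<dots> < r" using \<open>r > 0\<close> by simp
    finally have "norm (z'' - z) < r" .
    moreover have "norm (g z'') = norm (g z')" if "g \<in> bounded_hom_polys sX sY n" for g
      using c c' hom_poly_scale[OF that sY, of "c' / c" z']
      by (simp add: z''_def Y.norm_scale norm_power norm_divide)
    moreover have "z'' \<in> cball 0 1" using z c c' by (simp add: z''_def X.norm_scale norm_divide)
    ultimately show "\<exists>z''\<in>cball 0 1. (\<forall>g\<in>bounded_hom_polys sX sY n. norm (g z'') = norm (g z')) \<and>
      norm (z'' - z) < r" by blast
  qed
qed

section \<open>Density for homogeneous polynomials\<close>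

theorem norm_attaining_hom_polys_dense:
  fixes sX :: "'k::real_or_complex \<Rightarrow> 'a::banach \<Rightarrow> 'a" and sY :: "'k \<Rightarrow> 'b::banach \<Rightarrow> 'b"
  assumes sX: "normed_space_over sX" and sY: "normed_space_over sY" and n: "n \<ge> 1"
    and E: "uniformly_strongly_exposed sX E"
    and nm: "\<And>P \<eta>. \<lbrakk>P \<in> bounded_hom_polys sX sY n; \<eta> > 0\<rbrakk> \<Longrightarrow> \<exists>x\<in>E. norm (P x) > sup_norm P - \<eta>"
  shows "sup_norm_dense_in {P \<in> bounded_hom_polys sX sY n. norm_attaining P} (bounded_hom_polys sX sY n)"
proof -
  obtain \<delta> :: "real \<Rightarrow> real" and f where ES: "E \<subseteq> sphere 0 1" and \<delta>: "\<And>\<epsilon>. \<epsilon> > 0 \<Longrightarrow> \<delta> \<epsilon> > 0"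
    and f: "\<And>a. a \<in> E \<Longrightarrow> f a \<in> dual_space sX" "\<And>a. a \<in> E \<Longrightarrow> onorm (f a) = 1" "\<And>a. a \<in> E \<Longrightarrow> f a a = 1"
    and exp: "\<And>a \<epsilon> x. \<lbrakk>a \<in> E; \<epsilon> > 0; norm x \<le> 1; re_part (f a x) \<ge> 1 - \<delta> \<epsilon>\<rbrakk> \<Longrightarrow> norm (x - a) \<le> \<epsilon>"
  proof -
    obtain \<delta> :: "real \<Rightarrow> real" and f where \<delta>: "\<forall>\<epsilon>>0. \<delta> \<epsilon> > 0"
      and f: "\<forall>a\<in>E. f a \<in> dual_space sX \<and> onorm (f a) = 1 \<and> f a a = 1 \<and>
        (\<forall>\<epsilon>>0. \<forall>x. norm x \<le> 1 \<and> re_part (f a x) \<ge> 1 - \<delta> \<epsilon> \<longrightarrow> norm (x - a) \<le> \<epsilon>)"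
    proof -
      from E have "\<exists>\<delta> f. (\<forall>\<epsilon>>0. \<delta> \<epsilon> > 0) \<and>
        (\<forall>a\<in>E. f a \<in> dual_space sX \<and> onorm (f a) = 1 \<and> f a a = 1 \<and>
          (\<forall>\<epsilon>>0. \<forall>x. norm x \<le> 1 \<and> re_part (f a x) \<ge> 1 - \<delta> \<epsilon> \<longrightarrow> norm (x - a) \<le> \<epsilon>))"
        unfolding uniformly_strongly_exposed_def by (rule conjunct2)
      then show ?thesis by (elim exE conjE) (rule that)
    qed
    show ?thesis
    proof (rule that[of \<delta> f])
      show "E \<subseteq> sphere 0 1" using E by (simp add: uniformly_strongly_exposed_def)
    qed (use \<delta> f in simp_all)
  qed
  define \<Phi> where "\<Phi> = {(\<lambda>z. \<phi> z ^ n) | \<phi>. \<phi> \<in> dual_space sX \<and> onorm \<phi> \<le> 1}"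
  show ?thesis
  proof (rule norm_attaining_dense_by_bumps[OF sY, where \<Phi> = \<Phi>])
    fix P assume P: "P \<in> bounded_hom_polys sX sY n"
    then show "bounded (P ` cball 0 1)" by (simp add: bounded_hom_polys_def)
    show "continuous_on (cball 0 1) P" by (rule continuous_on_hom_poly[OF P sX sY])
  next
    fix \<phi> :: "'a \<Rightarrow> 'k" and z :: 'a assume "\<phi> \<in> \<Phi>" "z \<in> cball 0 1"
    then show "norm (\<phi> z) \<le> 1"
      using dual_space_norm_le_1 by (fastforce simp: \<Phi>_def norm_power intro: power_le_one)
  next
    fix P and \<phi> :: "nat \<Rightarrow> 'a \<Rightarrow> 'k" and v :: "nat \<Rightarrow> 'b"
    assume P: "P \<in> bounded_hom_polys sX sY n" and "\<And>k. \<phi> k \<in> \<Phi>" and v: "summable (\<lambda>k. norm (v k))"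
    then have "\<exists>\<psi>. \<psi> \<in> dual_space sX \<and> onorm \<psi> \<le> 1 \<and> \<phi> k = (\<lambda>z. \<psi> z ^ n)" for k
      unfolding \<Phi>_def by blast
    then obtain \<psi> where \<psi>: "\<And>k. \<psi> k \<in> dual_space sX" "\<And>k. onorm (\<psi> k) \<le> 1" "\<And>k. \<phi> k = (\<lambda>z. \<psi> k z ^ n)"
      by metis
    show "(\<lambda>z. P z + (\<Sum>k. sY (\<phi> k z) (v k))) \<in> bounded_hom_polys sX sY n"
      unfolding \<psi>(3) by (intro hom_poly_add[OF P _ sY] suminf_powers_hom_poly[OF sX sY \<psi>(1,2) v])
  next
    fix r :: real assume r: "r > 0"
    \<comment> \<open>Uniform exposure makes \<open>t\<close> depend on \<open>r\<close> only. The
      cap \<open>1/2\<close> gives \<open>t < 1\<close>, so that the functional is nonzero wherever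
      the bump exceeds \<open>1 - t\<close> and its value can be rotated.\<close>
    define t where "t = min (1/2) (\<delta> (r / 3))"
    have t: "0 < t" "t < 1" "t \<le> \<delta> (r / 3)" using \<delta>[of "r / 3"] r by (auto simp: t_def)
    have "\<exists>x\<in>cball 0 1. \<exists>\<phi>\<in>\<Phi>. sup_norm P - \<eta> < norm (P x) \<and> \<phi> x = 1 \<and>
        peaks_within (bounded_hom_polys sX sY n) \<phi> t r"
      if P: "P \<in> bounded_hom_polys sX sY n" and "\<eta> > 0" for P \<eta>
    proof -
      obtain a where a: "a \<in> E" "norm (P a) > sup_norm P - \<eta>" using nm[OF P \<open>\<eta> > 0\<close>] by blast
      have "peaks_within (bounded_hom_polys sX sY n) (\<lambda>z. f a z ^ n) t r"
        by (rule peaks_within_rotation[OF sX sY n f(1)[OF a(1)] _ t(1,2) r, where a = a])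
          (use f(2)[OF a(1)] exp[OF a(1), of "r / 3"] t r in auto)
      moreover have "(\<lambda>z. f a z ^ n) \<in> \<Phi>" using f[OF a(1)] by (auto simp: \<Phi>_def)
      moreover have "a \<in> cball 0 1" using a ES by auto
      ultimately show ?thesis using a f(3)[OF a(1)] by (intro bexI[of _ a] bexI[of _ "\<lambda>z. f a z ^ n"]) auto
    qed
    with t show "\<exists>t>0. \<forall>P\<in>bounded_hom_polys sX sY n. \<forall>\<eta>>0. \<exists>x\<in>cball 0 1. \<exists>\<phi>\<in>\<Phi>.
        sup_norm P - \<eta> < norm (P x) \<and> \<phi> x = 1 \<and> peaks_within (bounded_hom_polys sX sY n) \<phi> t r"
      by blast
  qed
qed

text \<open>By homogeneity of positive degree, moving a nonzero point radially out to the sphere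
  does not decrease the norm; continuity then allows a move into \<open>E\<close>.\<close>

lemma hom_poly_almost_max_on_dense:
  fixes P :: "'a::real_normed_vector \<Rightarrow> 'b::real_normed_vector"
  assumes sX: "normed_space_over sX" and sY: "normed_space_over sY" and n: "n \<ge> 1"
    and P: "P \<in> bounded_hom_polys sX sY n" and nontriv: "\<exists>x::'a. x \<noteq> 0"
    and E: "E \<subseteq> sphere 0 1" "sphere 0 1 \<subseteq> closure E" and "\<eta> > 0"
  shows "\<exists>x\<in>E. norm (P x) > sup_norm P - \<eta>"
proof -
  obtain z where z: "z \<in> cball 0 1" "norm (P z) > sup_norm P - \<eta> / 2"
    using ex_norm_gt_sup_norm_minus[of "\<eta> / 2" P] \<open>\<eta> > 0\<close> by auto
  obtain w where w: "w \<in> sphere 0 1" "norm (P z) \<le> norm (P w)"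
  proof (cases "z = 0")
    case True
    obtain x :: 'a where "x \<noteq> 0" using nontriv by blast
    then have "sgn x \<in> sphere 0 1" by (simp add: norm_sgn)
    with that True show ?thesis by (simp add: hom_poly_zero[OF P sX sY n])
  next
    case False
    have "P z = norm z ^ n *\<^sub>R P (sgn z)"
      using False by (simp flip: hom_poly_scaleR[OF P sX sY] add: sgn_div_norm)
    moreover have "norm z ^ n * norm (P (sgn z)) \<le> 1 * norm (P (sgn z))"
      using z by (intro mult_right_mono power_le_one) auto
    ultimately have "norm (P z) \<le> norm (P (sgn z))" by simp
    with that[of "sgn z"] False show ?thesis by (simp add: norm_sgn)
  qed
  obtain d where d: "d > 0" "\<And>x. x \<in> cball 0 1 \<Longrightarrow> dist x w < d \<Longrightarrow> dist (P x) (P w) < \<eta> / 2"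
    using continuous_on_hom_poly[OF P sX sY, unfolded continuous_on_iff, rule_format, of w "\<eta> / 2"]
      w \<open>\<eta> > 0\<close> by auto
  obtain x where x: "x \<in> E" "dist x w < d"
    using w(1) E(2) d(1) closure_approachable by blast
  then have "dist (P x) (P w) < \<eta> / 2" using d(2) E(1) by auto
  then have "norm (P w) - norm (P x) < \<eta> / 2"
    using norm_triangle_ineq2[of "P w" "P x"] by (simp add: dist_norm norm_minus_commute)
  with z w x(1) show ?thesis by (intro bexI[of _ x]) auto
qed

lemma norming_almost_max:
  assumes "norming sX sY n E" "E \<noteq> {}" "P \<in> bounded_hom_polys sX sY n" "\<eta> > 0"
  shows "\<exists>x\<in>E. norm (P x) > sup_norm P - \<eta>"
proof (rule ccontr)
  assume "\<not> ?thesis"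
  then have "norm (P x) \<le> sup_norm P - \<eta>" if "x \<in> E" for x using that by force
  then have "(SUP x\<in>E. norm (P x)) \<le> sup_norm P - \<eta>" using assms(2) by (intro cSUP_least)
  with assms show False by (simp add: norming_def)
qed

text \<open>The supremum over the empty set is one fixed real number, so a norming empty set forces
  every polynomial to have the norm of the zero polynomial.\<close>

lemma norming_empty_norm_attaining:
  fixes P :: "'b::real_normed_vector \<Rightarrow> 'c::real_normed_vector"
  assumes sX: "normed_space_over sX" and sY: "normed_space_over sY"
    and nm: "norming sX sY n {}" and P: "P \<in> bounded_hom_polys sX sY n"
  shows "norm_attaining P"
proof -
  have "(\<lambda>x. 0) \<in> bounded_hom_polys sX sY n"
  proof -
    interpret X: normed_space_over sX by fact
    interpret Y: normed_space_over sY by fact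
    have "Vector_Spaces.linear sX sY (\<lambda>x. 0)"
      by (simp add: Vector_Spaces.linear_iff X.vector_space_axioms Y.vector_space_axioms)
    then have "multilinear sX sY n (\<lambda>_. 0)" by (simp add: multilinear_def)
    moreover have "bounded ((\<lambda>x::'b. 0::'c) ` cball 0 1)" by (rule bounded_image_cballI[of _ 0]) simp
    ultimately show ?thesis unfolding bounded_hom_polys_def by blast
  qed
  then have "sup_norm P = sup_norm (\<lambda>x::'b. 0 :: 'c)" using nm P by (simp add: norming_def)
  also have "\<dots> \<le> 0" by (rule sup_norm_le) simp
  finally show ?thesis
    using P by (intro norm_attaining_if_sup_norm_le_0) (auto simp: bounded_hom_polys_def)
qed

section \<open>Analytic functions\<close>

lemma sum_powers_root_of_unity:
  assumes "0 < m" "m < M"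
  shows "(\<Sum>j<M. (cis (2 * pi / real M) ^ m) ^ j) = 0"
proof -
  have e: "cis (2 * pi / real M) ^ k = exp (2 * of_real pi * \<i> * of_nat k / of_nat M)" for k
  proof -
    have "\<i> * complex_of_real (real k * (2 * pi / real M)) = 2 * of_real pi * \<i> * of_nat k / of_nat M"
      by simp
    then show ?thesis unfolding Complex.DeMoivre by (simp only: cis_conv_exp)
  qed
  have "cis (2 * pi / real M) ^ m \<noteq> 1"
    unfolding e using complex_root_unity_eq_1[of M m] assms by (auto dest: dvd_imp_le)
  moreover have "(cis (2 * pi / real M) ^ m) ^ M = 1"
    unfolding power_mult[symmetric] unfolding e
    using complex_root_unity_eq_1[of M "m * M"] assms by simp
  ultimately show ?thesis by (simp add: geometric_sum)
qed

text \<open>The cross term is a multiple of a sum of roots of unity and vanishes. What remains is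
  the excess \<open>\<rho>\<^sup>2\<close> over the value at the centre, the source of strictness in
  the maximum principle.\<close>

lemma mean_norm_sq_circle:
  assumes "M \<ge> 2"
  shows "(\<Sum>j<M. (norm (z + of_real \<rho> * cis (2 * pi / real M) ^ j))\<^sup>2) = real M * ((norm z)\<^sup>2 + \<rho>\<^sup>2)"
proof -
  let ?w = "\<lambda>j. cis (2 * pi / real M) ^ j"
  define q where "q j = cnj z * of_real \<rho> * ?w j" for j
  have "(norm (z + of_real \<rho> * ?w j))\<^sup>2 = ((norm z)\<^sup>2 + \<rho>\<^sup>2) + 2 * Re (q j)" for j
  proof -
    have "(norm (of_real \<rho> * ?w j))\<^sup>2 = \<rho>\<^sup>2"
      by (simp add: norm_mult norm_power power_mult_distrib)
    then show ?thesis unfolding cmod_power2 q_def by (simp add: power2_eq_square algebra_simps)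
  qed
  then have "(\<Sum>j<M. (norm (z + of_real \<rho> * ?w j))\<^sup>2) =
      real M * ((norm z)\<^sup>2 + \<rho>\<^sup>2) + 2 * Re (\<Sum>j<M. q j)"
    unfolding Re_sum by (simp add: sum.distrib sum_distrib_left distrib_left)
  also have "(\<Sum>j<M. q j) = cnj z * of_real \<rho> * (\<Sum>j<M. (cis (2 * pi / real M) ^ 1) ^ j)"
    by (simp only: q_def sum_distrib_left power_one_right)
  also have "\<dots> = 0" using sum_powers_root_of_unity[of 1 M] assms by simp
  finally show ?thesis by simp
qed

text \<open>Adding a small multiple of \<open>\<bar>z\<bar>\<^sup>2\<close> makes the mean value inequality strict, so the maximum
  cannot be interior.\<close>

lemma submean_max_on_circle:
  fixes u :: "complex \<Rightarrow> real"
  assumes cont: "continuous_on (cball 0 1) u"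
    and mean: "\<And>z. z \<in> ball 0 1 \<Longrightarrow> \<exists>\<rho>>0. cball z \<rho> \<subseteq> cball 0 1 \<and>
      (\<forall>\<eta>>0. \<exists>M\<ge>2. u z \<le> (\<Sum>j<M. u (z + of_real \<rho> * cis (2 * pi / real M) ^ j)) / real M + \<eta>)"
    and z: "z \<in> cball 0 1"
  shows "\<exists>w\<in>sphere 0 1. u z \<le> u w"
proof (rule ccontr)
  assume "\<not> ?thesis"
  then have less: "u w < u z" if "w \<in> sphere 0 1" for w using that not_le by blast
  have "\<exists>w\<in>sphere 0 1. \<forall>y\<in>sphere 0 1. u y \<le> u w"
    by (intro continuous_attains_sup continuous_on_subset[OF cont]) (auto intro!: exI[of _ 1])
  then obtain w where w: "w \<in> sphere 0 1" "\<And>y. y \<in> sphere 0 1 \<Longrightarrow> u y \<le> u w" by blast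
  \<comment> \<open>Small enough for \<open>v\<close> on the circle to stay below
    \<open>u z\<close>, hence below the maximum of \<open>v\<close>.\<close>
  define c where "c = (u z - u w) / 2"
  have c: "c > 0" using less[OF w(1)] by (simp add: c_def)
  define v where "v = (\<lambda>y. u y + c * (norm y)\<^sup>2)"
  have "\<exists>a\<in>cball 0 1. \<forall>y\<in>cball 0 1. v y \<le> v a"
    unfolding v_def by (intro continuous_attains_sup continuous_intros cont) auto
  then obtain a where a: "a \<in> cball 0 1" "\<And>y. y \<in> cball 0 1 \<Longrightarrow> v y \<le> v a" by blast
  have "a \<in> ball 0 1"
  proof (rule ccontr)
    assume "a \<notin> ball 0 1"
    with a(1) have s: "a \<in> sphere 0 1" by auto
    then have "v a \<le> u w + c" using w(2)[OF s] by (simp add: v_def)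
    also have "\<dots> < u z" using less[OF w(1)] by (simp add: c_def field_simps)
    also have "\<dots> \<le> v z" using c by (simp add: v_def)
    finally show False using a(2)[OF z] by simp
  qed
  then obtain \<rho> where \<rho>: "\<rho> > 0" "cball a \<rho> \<subseteq> cball 0 1"
    and m: "\<And>\<eta>. \<eta> > 0 \<Longrightarrow> \<exists>M\<ge>2. u a \<le> (\<Sum>j<M. u (a + of_real \<rho> * cis (2 * pi / real M) ^ j)) / real M + \<eta>"
    using mean by blast
  \<comment> \<open>Half of the gain \<open>c * \<rho>\<^sup>2\<close> is spent on the error term;
    the other half gives the contradiction.\<close>
  have "c * \<rho>\<^sup>2 / 2 > 0" using c \<rho> by simp
  from m[OF this] obtain M where M: "M \<ge> 2"
    and le: "u a \<le> (\<Sum>j<M. u (a + of_real \<rho> * cis (2 * pi / real M) ^ j)) / real M + c * \<rho>\<^sup>2 / 2"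
    by blast
  let ?p = "\<lambda>j. a + of_real \<rho> * cis (2 * pi / real M) ^ j"
  have "?p j \<in> cball a \<rho>" for j using \<rho> by (simp add: dist_norm norm_mult norm_power)
  then have "v (?p j) \<le> v a" for j using \<rho>(2) a(2) by blast
  then have "(\<Sum>j<M. v (?p j)) \<le> (\<Sum>j<M. v a)" by (intro sum_mono)
  then have 1: "(\<Sum>j<M. v (?p j)) \<le> real M * v a" by simp
  have "(\<Sum>j<M. v (?p j)) = (\<Sum>j<M. u (?p j)) + c * (real M * ((norm a)\<^sup>2 + \<rho>\<^sup>2))"
    unfolding v_def sum.distrib sum_distrib_left[symmetric] mean_norm_sq_circle[OF M] ..
  moreover have "real M * (u a - c * \<rho>\<^sup>2 / 2) \<le> (\<Sum>j<M. u (?p j))"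
    using le M by (simp add: field_simps)
  moreover have "real M * (c * \<rho>\<^sup>2 / 2) > 0" using M c \<rho> by simp
  ultimately show False using 1 unfolding v_def by (simp add: algebra_simps)
qed

text \<open>The mean over the \<open>M\<close>-th roots of unity kills all terms of degree \<open>1\<close> to \<open>M - 1\<close> of the
  local power series.\<close>

lemma analytic_discrete_submean:
  assumes cX: "normed_space_over cX" and cY: "normed_space_over cY"
    and f: "banach_analytic_on cX cY U f" and a: "a \<in> U" and e: "norm e = 1"
  shows "\<exists>\<rho>>0. cball a \<rho> \<subseteq> U \<and> (\<forall>\<eta>>0. \<exists>M\<ge>2. norm (f a) \<le>
    (\<Sum>j<M. norm (f (a + cX (of_real \<rho> * cis (2 * pi / real M) ^ j) e))) / real M + \<eta>)"
proof -
  interpret X: normed_space_over cX by fact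
  interpret Y: normed_space_over cY by fact
  obtain r P where r: "r > 0" "ball a r \<subseteq> U" and P: "\<And>m. P m \<in> bounded_hom_polys cX cY m"
    and lim: "uniform_limit (ball a r) (\<lambda>N x. \<Sum>m<N. P m (x - a)) f sequentially"
    using f a unfolding banach_analytic_on_def by blast
  define \<rho> where "\<rho> = r / 2"
  have \<rho>: "\<rho> > 0" "\<rho> < r" using r by (auto simp: \<rho>_def)
  have "\<exists>M\<ge>2. norm (f a) \<le>
      (\<Sum>j<M. norm (f (a + cX (of_real \<rho> * cis (2 * pi / real M) ^ j) e))) / real M + \<eta>"
    if \<eta>: "\<eta> > 0" for \<eta>
  proof -
    obtain N where N: "\<And>n x. n \<ge> N \<Longrightarrow> x \<in> ball a r \<Longrightarrow> dist (\<Sum>m<n. P m (x - a)) (f x) < \<eta> / 2"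
      using lim \<eta> unfolding uniform_limit_iff eventually_sequentially by (meson half_gt_zero)
    \<comment> \<open>\<open>M\<close> is both the truncation index and the number of roots, so
      averaging the truncated series leaves exactly its constant term. Errors of
      \<open>\<eta> / 2\<close> arise at the centre and on the circle.\<close>
    define M where "M = max N 2"
    have M: "M \<ge> 2" "M \<ge> N" by (auto simp: M_def)
    define \<omega> where "\<omega> = cis (2 * pi / real M)"
    define h where "h = cX (of_real \<rho>) e"
    define S where "S x = (\<Sum>m<M. P m (x - a))" for x
    define z where "z j = a + cX (of_real \<rho> * \<omega> ^ j) e" for j
    have nw: "norm (\<omega> ^ j) = 1" for j by (simp add: \<omega>_def norm_power)
    have zb: "z j \<in> ball a r" for j
      using \<rho> e by (simp add: z_def dist_norm X.norm_scale norm_mult nw)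
    have zh: "z j - a = cX (\<omega> ^ j) h" for j by (simp add: z_def h_def mult.commute)
    have close: "norm (S x - f x) < \<eta> / 2" if "x \<in> ball a r" for x
      using N[OF M(2) that] by (simp add: S_def dist_norm)
    \<comment> \<open>A polynomial of degree 0 is constant: scaling its argument by 0 multiplies its
      value by \<open>0 ^ 0 = 1\<close>.\<close>
    have P0: "P 0 x = P 0 0" for x
      using hom_poly_scaleR[OF P[of 0] cX cY, of 0 x] by simp
    have "S a = (\<Sum>m<M. if m = 0 then P 0 0 else 0)"
      unfolding S_def by (intro sum.cong) (auto simp: hom_poly_zero[OF P cX cY])
    also have "\<dots> = P 0 0" using M by simp
    finally have Sa: "S a = P 0 0" .
    have "(\<Sum>j<M. S (z j)) = (\<Sum>j<M. \<Sum>m<M. cY ((\<omega> ^ m) ^ j) (P m h))"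
      by (simp add: S_def zh hom_poly_scale[OF P cY] power_mult[symmetric] mult.commute)
    also have "\<dots> = (\<Sum>m<M. cY (\<Sum>j<M. (\<omega> ^ m) ^ j) (P m h))"
      by (subst sum.swap) (simp add: Y.scale_sum_left)
    also have "\<dots> = (\<Sum>m<M. if m = 0 then cY (of_real (real M)) (P 0 h) else 0)"
      using sum_powers_root_of_unity[of _ M] by (intro sum.cong) (auto simp: \<omega>_def)
    also have "\<dots> = cY (of_real (real M)) (P 0 h)" using M by simp
    also have "\<dots> = real M *\<^sub>R S a" by (simp only: Y.scale_of_real Sa P0[of h])
    finally have mean: "real M * norm (S a) = norm (\<Sum>j<M. S (z j))" by simp
    have "norm (S x) \<le> norm (f x) + \<eta> / 2" if "x \<in> ball a r" for x
      using close[OF that] norm_triangle_ineq2[of "S x" "f x"] by linarith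
    then have "norm (\<Sum>j<M. S (z j)) \<le> (\<Sum>j<M. norm (f (z j)) + \<eta> / 2)"
      using zb by (intro sum_norm_le) blast
    then have "real M * norm (S a) \<le> (\<Sum>j<M. norm (f (z j))) + real M * (\<eta> / 2)"
      by (simp add: mean sum.distrib)
    moreover have "norm (f a) \<le> norm (S a) + \<eta> / 2"
      using close[of a] r norm_triangle_ineq2[of "f a" "S a"] by (simp add: norm_minus_commute)
    then have "real M * norm (f a) \<le> real M * (norm (S a) + \<eta> / 2)" by (intro mult_left_mono) auto
    ultimately have "norm (f a) \<le> (\<Sum>j<M. norm (f (z j))) / real M + \<eta>"
      using M by (simp add: field_simps)
    with M(1) show ?thesis unfolding z_def \<omega>_def by blast
  qed
  moreover have "cball a \<rho> \<subseteq> U" using \<rho> r(2) by (auto simp: subset_eq)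
  ultimately show ?thesis using \<rho>(1) by blast
qed

text \<open>The ball need not be compact, but the complex line through \<open>z\<close> meets it in
  a closed disc. On this disc the norm of \<open>f\<close> is continuous and satisfies the submean
  inequality, so some boundary point dominates \<open>z\<close>.\<close>

lemma A_b_max_on_sphere:
  fixes f :: "'a::real_normed_vector \<Rightarrow> 'b::real_normed_vector"
  assumes cX: "normed_space_over cX" and cY: "normed_space_over cY"
    and f: "f \<in> A_b cX cY" and nontriv: "\<exists>x::'a. x \<noteq> 0" and z: "z \<in> cball 0 1"
  shows "\<exists>w\<in>sphere 0 1. norm (f z) \<le> norm (f w)"
proof -
  interpret X: normed_space_over cX by fact
  obtain e where e: "norm e = 1" "z = cX (of_real (norm z)) e"
  proof (cases "z = 0")
    case True
    obtain x :: 'a where "x \<noteq> 0" using nontriv by blast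
    with that[of "sgn x"] True show ?thesis by (simp add: norm_sgn)
  next
    case False
    with that[of "sgn z"] show ?thesis by (simp add: norm_sgn X.scale_of_real sgn_div_norm)
  qed
  define u where "u \<zeta> = norm (f (cX \<zeta> e))" for \<zeta>
  have n: "norm (cX \<zeta> e) = norm \<zeta>" for \<zeta> by (simp add: X.norm_scale e)
  have "continuous_on (cball 0 1) u"
    unfolding u_def
  proof (rule continuous_on_norm, rule continuous_on_compose2[of "cball 0 1" f])
    show "continuous_on (cball 0 1) f" using f by (simp add: A_b_def)
    show "continuous_on (cball 0 1) (\<lambda>\<zeta>. cX \<zeta> e)"
      by (intro linear_continuous_on X.bounded_linear_scale_left)
  qed (auto simp: n)
  moreover have "\<exists>\<rho>>0. cball \<zeta> \<rho> \<subseteq> cball 0 1 \<and> (\<forall>\<eta>>0. \<exists>M\<ge>2.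
      u \<zeta> \<le> (\<Sum>j<M. u (\<zeta> + of_real \<rho> * cis (2 * pi / real M) ^ j)) / real M + \<eta>)"
    if "\<zeta> \<in> ball 0 1" for \<zeta>
  proof -
    have "cX \<zeta> e \<in> ball 0 1" using that by (simp add: n)
    then have a: "cX \<zeta> e \<in> interior (cball 0 1)"
      by (meson ball_subset_cball interior_maximal open_ball subsetD)
    have "banach_analytic_on cX cY (interior (cball 0 1)) f" using f by (simp add: A_b_def)
    from analytic_discrete_submean[OF cX cY this a e(1)] obtain \<rho> where \<rho>: "\<rho> > 0"
      "cball (cX \<zeta> e) \<rho> \<subseteq> interior (cball 0 1)" and m: "\<forall>\<eta>>0. \<exists>M\<ge>2. norm (f (cX \<zeta> e)) \<le>
        (\<Sum>j<M. norm (f (cX \<zeta> e + cX (of_real \<rho> * cis (2 * pi / real M) ^ j) e))) / real M + \<eta>"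
      by blast
    have "\<mu> \<in> cball 0 1" if "\<mu> \<in> cball \<zeta> \<rho>" for \<mu>
    proof -
      have "cX \<mu> e \<in> cball (cX \<zeta> e) \<rho>"
        using that by (simp add: dist_norm X.scale_left_diff_distrib[symmetric] n)
      then have "cX \<mu> e \<in> cball 0 1" using \<rho>(2) interior_subset by blast
      then show ?thesis by (simp add: n)
    qed
    with \<rho>(1) m show ?thesis unfolding u_def by (auto simp: X.scale_left_distrib)
  qed
  moreover have "of_real (norm z) \<in> (cball 0 1 :: complex set)" using z by simp
  ultimately obtain w where "w \<in> sphere 0 1" "u (of_real (norm z)) \<le> u w"
    using submean_max_on_circle by blast
  with e(2) show ?thesis by (intro bexI[of _ "cX w e"]) (auto simp: u_def n)
qed

section \<open>Series of peak functions\<close>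

lemma norm_half_one_plus_le_1:
  assumes "norm (w::complex) \<le> 1"
  shows "norm ((1 + w) / 2) \<le> 1"
  using norm_triangle_ineq[of 1 w] assms by (simp add: norm_divide)

lemma uniformly_continuous_on_uniform_limit:
  fixes f :: "nat \<Rightarrow> 'a::metric_space \<Rightarrow> 'b::metric_space"
  assumes "uniform_limit S f l sequentially" "\<And>n. uniformly_continuous_on S (f n)"
  shows "uniformly_continuous_on S l"
  unfolding uniformly_continuous_on_def
proof (intro allI impI)
  fix e :: real assume e: "e > 0"
  then have "\<forall>\<^sub>F n in sequentially. \<forall>x\<in>S. dist (f n x) (l x) < e / 3"
    using assms(1) unfolding uniform_limit_iff by (meson divide_pos_pos zero_less_numeral)
  then obtain n where n: "\<And>x. x \<in> S \<Longrightarrow> dist (f n x) (l x) < e / 3"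
    unfolding eventually_sequentially by blast
  obtain d where d: "d > 0" "\<And>x y. \<lbrakk>x \<in> S; y \<in> S; dist y x < d\<rbrakk> \<Longrightarrow> dist (f n y) (f n x) < e / 3"
    using assms(2)[of n, unfolded uniformly_continuous_on_def, rule_format, of "e / 3"] e by auto
  have "dist (l y) (l x) < e" if "x \<in> S" "y \<in> S" "dist y x < d" for x y
  proof -
    have "dist (l y) (l x) \<le> dist (l y) (f n y) + dist (f n y) (f n x) + dist (f n x) (l x)"
      by (meson add_right_mono dist_triangle order_trans)
    also have "\<dots> < e" using n[OF that(1)] n[OF that(2)] d(2)[OF that] by (simp add: dist_commute)
    finally show ?thesis .
  qed
  with d(1) show "\<exists>d>0. \<forall>x\<in>S. \<forall>y\<in>S. dist y x < d \<longrightarrow> dist (l y) (l x) < e" by blast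
qed

text \<open>The exponents \<open>N k\<close> may be unbounded, so the terms have no common degree.
  Uniform in \<open>k\<close> is the absolute Taylor sum at \<open>a\<close> on radius
  \<open>r\<close>: it equals \<open>(r / 2 + norm (c k)) ^ N k\<close> and is at most 1. Hence high
  truncations reproduce the first \<open>K\<close> terms exactly, while the rest contribute at most
  twice the tail of \<open>norm (v k)\<close>.\<close>

lemma banach_analytic_on_suminf_peaks:
  fixes cX :: "complex \<Rightarrow> 'a::real_normed_vector \<Rightarrow> 'a" and cY :: "complex \<Rightarrow> 'b::banach \<Rightarrow> 'b"
  assumes cX: "normed_space_over cX" and cY: "normed_space_over cY"
    and \<phi>: "\<And>k. \<phi> k \<in> dual_space cX" "\<And>k. onorm (\<phi> k) \<le> 1" and v: "summable (\<lambda>k. norm (v k))"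
  shows "banach_analytic_on cX cY (interior (cball 0 1)) (\<lambda>z. \<Sum>k. cY (((1 + \<phi> k z) / 2) ^ N k) (v k))"
  unfolding banach_analytic_on_def
proof
  interpret X: normed_space_over cX by fact
  interpret Y: normed_space_over cY by fact
  fix a :: 'a assume "a \<in> interior (cball 0 1)"
  then obtain s where s: "s > 0" "cball a s \<subseteq> cball 0 1" unfolding mem_interior_cball by blast
  have na: "norm a < 1"
  proof (cases "a = 0")
    case False
    have "a + s *\<^sub>R sgn a \<in> cball a s" using s by (simp add: dist_norm norm_sgn)
    then have "norm (a + s *\<^sub>R sgn a) \<le> 1" using s(2) by auto
    moreover have "a + s *\<^sub>R sgn a = (norm a + s) *\<^sub>R sgn a"
      using False by (simp add: sgn_div_norm scaleR_left_distrib distrib_right)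
    ultimately show ?thesis using s False by (simp add: norm_sgn)
  qed simp
  \<comment> \<open>Since \<open>norm (c k) \<le> (1 + norm a) / 2\<close>, this radius makes
    \<open>r / 2 + norm (c k)\<close> at most 1; it also keeps \<open>ball a r\<close> inside the
    unit ball.\<close>
  define r where "r = 1 - norm a"
  have r: "r > 0" using na by (simp add: r_def)
  define c where "c k = (1 + \<phi> k a) / 2" for k
  define b where "b k m = of_nat (N k choose m) * c k ^ (N k - m) / 2 ^ m" for k m
  have nc: "r / 2 + norm (c k) \<le> 1" for k
    using norm_triangle_ineq[of 1 "\<phi> k a"] dual_space_norm_le[OF \<phi>, of k a]
    by (simp add: c_def r_def norm_divide field_simps)
  have b0: "b k m = 0" if "m > N k" for k m using that by (simp add: b_def)
  have bs: "(\<Sum>m<M. norm (b k m) * r ^ m) \<le> 1" for k M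
  proof -
    have "(\<Sum>m<M. norm (b k m) * r ^ m) \<le> (\<Sum>m\<in>{..<M} \<union> {..N k}. norm (b k m) * r ^ m)"
      using r by (intro sum_mono2) auto
    also have "\<dots> = (\<Sum>m\<le>N k. norm (b k m) * r ^ m)"
      by (rule sum.mono_neutral_right) (auto simp: b0)
    also have "\<dots> = (r / 2 + norm (c k)) ^ N k"
      unfolding binomial_ring
      by (intro sum.cong) (auto simp: b_def norm_mult norm_divide norm_power power_divide)
    also have "\<dots> \<le> 1" using r nc by (intro power_le_one) auto
    finally show ?thesis .
  qed
  \<comment> \<open>Bounded in \<open>k\<close>, the coefficients of order \<open>m\<close> can be
    absorbed into \<open>v\<close>, so that each \<open>P m\<close> below is a convergent
    series.\<close>
  have bm: "norm (b k m) \<le> 1 / r ^ m" for k m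
  proof -
    have "norm (b k m) * r ^ m \<le> (\<Sum>m<Suc m. norm (b k m) * r ^ m)"
      using r by (intro member_le_sum) auto
    also have "\<dots> \<le> 1" by (rule bs)
    finally show ?thesis using r by (simp add: field_simps)
  qed
  define P where "P m h = (\<Sum>k. cY (\<phi> k h ^ m) (cY (b k m) (v k)))" for m h
  have sb: "summable (\<lambda>k. norm (cY (b k m) (v k)))" for m
    by (rule summable_scale_bounded(1)[OF cY v bm])
  have P: "P m \<in> bounded_hom_polys cX cY m" for m
    unfolding P_def by (rule suminf_powers_hom_poly[OF cX cY \<phi> sb])
  have "uniform_limit (ball a r) (\<lambda>M x. \<Sum>m<M. P m (x - a))
      (\<lambda>z. \<Sum>k. cY (((1 + \<phi> k z) / 2) ^ N k) (v k)) sequentially"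
    unfolding uniform_limit_iff
  proof (intro allI impI)
    fix \<epsilon> :: real assume \<epsilon>: "\<epsilon> > 0"
    then obtain K where K: "norm (\<Sum>k. norm (v (k + K))) < \<epsilon> / 2"
      using suminf_exist_split[OF _ v, of "\<epsilon> / 2"] by auto
    \<comment> \<open>The lower bound on \<open>M\<close> exceeds each \<open>N k\<close> with
      \<open>k < K\<close>, so these binomial expansions are complete in the truncation.\<close>
    have "dist (\<Sum>m<M. P m (x - a)) (\<Sum>k. cY (((1 + \<phi> k x) / 2) ^ N k) (v k)) < \<epsilon>"
      if M: "M \<ge> Suc (\<Sum>k<K. N k)" and x: "x \<in> ball a r" for M x
    proof -
      define h where "h = x - a"
      have h: "norm h \<le> r" using x by (simp add: h_def dist_norm norm_minus_commute)
      have \<phi>h: "norm (\<phi> k h) \<le> r" for k using dual_space_norm_le[OF \<phi>, of k h] h by simp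
      have "norm x \<le> 1" using h norm_triangle_ineq[of a h] by (simp add: h_def r_def)
      then have xB: "x \<in> cball 0 1" by simp
      define T where "T k = (\<Sum>m<M. \<phi> k h ^ m * b k m)" for k
      define g where "g k = ((1 + \<phi> k x) / 2) ^ N k" for k
      have T1: "norm (T k) \<le> 1" for k
      proof -
        have "norm (T k) \<le> (\<Sum>m<M. norm (b k m) * r ^ m)"
          unfolding T_def
        proof (rule sum_norm_le)
          show "norm (\<phi> k h ^ m * b k m) \<le> norm (b k m) * r ^ m" for m
            using mult_left_mono[OF power_mono[OF \<phi>h[of k] norm_ge_zero, of m] norm_ge_zero[of "b k m"]]
            by (simp add: norm_mult norm_power mult.commute)
        qed
        with bs[of k M] show ?thesis by linarith
      qed
      have g1: "norm (g k) \<le> 1" for k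
        unfolding g_def norm_power
        by (intro power_le_one norm_ge_zero norm_half_one_plus_le_1 dual_space_norm_le_1[OF \<phi> xB])
      have Tg: "T k = g k" if "k < K" for k
      proof -
        have "N k \<le> (\<Sum>k<K. N k)" using that by (intro member_le_sum) auto
        then have NM: "N k < M" using M by linarith
        have "(1 + \<phi> k x) / 2 = \<phi> k h / 2 + c k"
          using dual_space_add[OF \<phi>(1), of k h a] by (simp add: h_def c_def field_simps)
        then have "g k = (\<phi> k h / 2 + c k) ^ N k" by (simp only: g_def)
        also have "\<dots> = (\<Sum>m\<le>N k. \<phi> k h ^ m * b k m)"
          unfolding binomial_ring by (intro sum.cong) (simp_all add: b_def power_divide)
        also have "\<dots> = T k"
          unfolding T_def using NM by (intro sum.mono_neutral_left) (auto simp: b0)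
        finally show ?thesis ..
      qed
      have s1: "summable (\<lambda>k. cY (\<phi> k h ^ m) (cY (b k m) (v k)))" for m
        by (rule summable_scale_bounded(2)[OF cY sb, of _ "r ^ m"])
          (simp add: norm_power power_mono \<phi>h)
      have s2: "summable (\<lambda>k. cY (T k) (v k))" "summable (\<lambda>k. cY (g k) (v k))"
        by (rule summable_scale_bounded(2)[OF cY v T1] summable_scale_bounded(2)[OF cY v g1])+
      have "(\<Sum>m<M. P m h) = (\<Sum>k. \<Sum>m<M. cY (\<phi> k h ^ m) (cY (b k m) (v k)))"
        unfolding P_def by (rule suminf_sum[symmetric]) (rule s1)
      also have "\<dots> = (\<Sum>k. cY (T k) (v k))"
        by (simp add: T_def Y.scale_sum_left)
      finally have "(\<Sum>m<M. P m h) - (\<Sum>k. cY (g k) (v k)) = (\<Sum>k. cY (T k - g k) (v k))"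
        by (simp add: suminf_diff[OF s2] Y.scale_left_diff_distrib)
      also have "\<dots> = (\<Sum>k. cY (T (k + K) - g (k + K)) (v (k + K)))"
      proof -
        have "summable (\<lambda>k. cY (T k - g k) (v k))"
          using summable_diff[OF s2] by (simp add: Y.scale_left_diff_distrib)
        from suminf_split_initial_segment[OF this, of K] show ?thesis by (simp add: Tg)
      qed
      also have "norm \<dots> \<le> (\<Sum>k. 2 * norm (v (k + K)))"
      proof (rule norm_suminf_le)
        show "norm (cY (T (k + K) - g (k + K)) (v (k + K))) \<le> 2 * norm (v (k + K))" for k
        proof -
          have "norm (T (k + K) - g (k + K)) \<le> 2"
            using norm_triangle_ineq4[of "T (k + K)" "g (k + K)"] T1[of "k + K"] g1[of "k + K"] by linarith
          then show ?thesis unfolding Y.norm_scale by (rule mult_right_mono) simp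
        qed
        show "summable (\<lambda>k. 2 * norm (v (k + K)))"
          using summable_ignore_initial_segment[OF v] by (intro summable_mult)
      qed
      also have "\<dots> = 2 * (\<Sum>k. norm (v (k + K)))"
        using summable_ignore_initial_segment[OF v] by (rule suminf_mult)
      also have "\<dots> < \<epsilon>" using K by simp
      finally show ?thesis by (simp add: dist_norm h_def g_def)
    qed
    then show "\<forall>\<^sub>F M in sequentially. \<forall>x\<in>ball a r.
        dist (\<Sum>m<M. P m (x - a)) (\<Sum>k. cY (((1 + \<phi> k x) / 2) ^ N k) (v k)) < \<epsilon>"
      unfolding eventually_sequentially by blast
  qed
  moreover have "ball a r \<subseteq> interior (cball 0 1)"
  proof (rule interior_maximal)
    show "ball a r \<subseteq> cball 0 1"
    proof
      fix x assume "x \<in> ball a r"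
      then show "x \<in> cball 0 1"
        using norm_triangle_ineq[of a "x - a"] by (simp add: r_def dist_norm norm_minus_commute)
    qed
  qed simp
  ultimately show "\<exists>r>0. ball a r \<subseteq> interior (cball 0 1) \<and>
      (\<exists>P. (\<forall>m. P m \<in> bounded_hom_polys cX cY m) \<and>
        uniform_limit (ball a r) (\<lambda>M x. \<Sum>m<M. P m (x - a))
          (\<lambda>z. \<Sum>k. cY (((1 + \<phi> k z) / 2) ^ N k) (v k)) sequentially)"
    using r P by blast
qed

text \<open>Partial sums are Lipschitz, with constants that grow with \<open>N k\<close>; uniform
  convergence carries over their uniform continuity. Landing in \<open>A_u\<close> lets the same
  perturbations serve both function spaces.\<close>

lemma suminf_peaks_A_u:
  fixes cX :: "complex \<Rightarrow> 'a::real_normed_vector \<Rightarrow> 'a" and cY :: "complex \<Rightarrow> 'b::banach \<Rightarrow> 'b"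
  assumes cX: "normed_space_over cX" and cY: "normed_space_over cY"
    and \<phi>: "\<And>k. \<phi> k \<in> dual_space cX" "\<And>k. onorm (\<phi> k) \<le> 1" and v: "summable (\<lambda>k. norm (v k))"
  shows "(\<lambda>z. \<Sum>k. cY (((1 + \<phi> k z) / 2) ^ N k) (v k)) \<in> A_u cX cY"
proof -
  interpret Y: normed_space_over cY by fact
  define g where "g k z = ((1 + \<phi> k z) / 2) ^ N k" for k z
  have g0: "norm ((1 + \<phi> k z) / 2) \<le> 1" if "z \<in> cball 0 1" for k z
    by (intro norm_half_one_plus_le_1 dual_space_norm_le_1[OF \<phi> that])
  have g1: "norm (cY (g k z) (v k)) \<le> norm (v k)" if "z \<in> cball 0 1" for k z
    using mult_right_mono[OF power_le_one[OF norm_ge_zero g0[OF that]], of "norm (v k)" k "N k"]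
    by (simp add: Y.norm_scale g_def norm_power)
  have "uniform_limit (cball 0 1) (\<lambda>n z. \<Sum>k<n. cY (g k z) (v k)) (\<lambda>z. \<Sum>k. cY (g k z) (v k)) sequentially"
    by (rule Weierstrass_m_test[OF g1 v])
  moreover have "uniformly_continuous_on (cball 0 1) (\<lambda>z. \<Sum>k<n. cY (g k z) (v k))" for n
  proof (rule lipschitz_on_uniformly_continuous)
    show "(\<Sum>k<n. real (N k) * norm (v k))-lipschitz_on (cball 0 1) (\<lambda>z. \<Sum>k<n. cY (g k z) (v k))"
    proof (rule lipschitz_onI)
      fix x y :: 'a assume xy: "x \<in> cball 0 1" "y \<in> cball 0 1"
      have gk: "norm (g k x - g k y) \<le> real (N k) * norm (x - y)" for k
      proof -
        have "norm (g k x - g k y) \<le> real (N k) * norm ((1 + \<phi> k x) / 2 - (1 + \<phi> k y) / 2)"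
          unfolding g_def by (rule norm_power_diff) (rule g0[OF xy(1)] g0[OF xy(2)])+
        also have "(1 + \<phi> k x) / 2 - (1 + \<phi> k y) / 2 = \<phi> k (x - y) / 2"
          using dual_space_add[OF \<phi>(1), of k "x - y" y] by (simp add: field_simps)
        also have "real (N k) * norm (\<phi> k (x - y) / 2) \<le> real (N k) * norm (x - y)"
          using order_trans[OF dual_space_norm_le[OF \<phi>, of k "x - y"], of "norm (x - y) * 2"]
          by (intro mult_left_mono) (auto simp: norm_divide)
        finally show ?thesis .
      qed
      have "(\<Sum>k<n. cY (g k x) (v k)) - (\<Sum>k<n. cY (g k y) (v k)) = (\<Sum>k<n. cY (g k x - g k y) (v k))"
        by (simp add: sum_subtractf Y.scale_left_diff_distrib)
      also have "norm \<dots> \<le> (\<Sum>k<n. real (N k) * norm (x - y) * norm (v k))"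
      proof (rule sum_norm_le)
        show "norm (cY (g k x - g k y) (v k)) \<le> real (N k) * norm (x - y) * norm (v k)" for k
          unfolding Y.norm_scale by (rule mult_right_mono[OF gk]) simp
      qed
      also have "\<dots> = (\<Sum>k<n. real (N k) * norm (v k)) * norm (x - y)"
        by (simp add: sum_distrib_left mult_ac)
      finally show "dist (\<Sum>k<n. cY (g k x) (v k)) (\<Sum>k<n. cY (g k y) (v k))
          \<le> (\<Sum>k<n. real (N k) * norm (v k)) * dist x y"
        by (simp add: dist_norm)
    qed (simp add: sum_nonneg)
  qed
  ultimately have u: "uniformly_continuous_on (cball 0 1) (\<lambda>z. \<Sum>k. cY (g k z) (v k))"
    by (rule uniformly_continuous_on_uniform_limit)
  moreover have "bounded ((\<lambda>z. \<Sum>k. cY (g k z) (v k)) ` cball 0 1)"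
    by (rule bounded_image_cballI) (rule norm_suminf_le[OF g1 v])
  ultimately show ?thesis
    using banach_analytic_on_suminf_peaks[OF cX cY \<phi> v, where N = N]
    by (simp add: A_u_def A_b_def g_def uniformly_continuous_imp_continuous)
qed

lemma A_b_add:
  fixes cX :: "complex \<Rightarrow> 'a::real_normed_vector \<Rightarrow> 'a"
  assumes cY: "normed_space_over cY" and f: "f \<in> A_b cX cY" and g: "g \<in> A_b cX cY"
  shows "(\<lambda>x. f x + g x) \<in> A_b cX cY"
proof -
  have "banach_analytic_on cX cY (interior (cball 0 1)) (\<lambda>x. f x + g x)"
    unfolding banach_analytic_on_def
  proof
    fix a :: 'a assume a: "a \<in> interior (cball 0 1)"
    obtain r P where r: "r > 0" "ball a r \<subseteq> interior (cball 0 1)" and P: "\<And>m. P m \<in> bounded_hom_polys cX cY m"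
      and limP: "uniform_limit (ball a r) (\<lambda>N x. \<Sum>m<N. P m (x - a)) f sequentially"
      using f a unfolding A_b_def banach_analytic_on_def by blast
    obtain s Q where s: "s > 0" and Q: "\<And>m. Q m \<in> bounded_hom_polys cX cY m"
      and limQ: "uniform_limit (ball a s) (\<lambda>N x. \<Sum>m<N. Q m (x - a)) g sequentially"
      using g a unfolding A_b_def banach_analytic_on_def by blast
    define t where "t = min r s"
    have t: "t > 0" "ball a t \<subseteq> ball a r" "ball a t \<subseteq> ball a s"
      using r s by (auto simp: t_def)
    have "uniform_limit (ball a t) (\<lambda>N x. (\<Sum>m<N. P m (x - a)) + (\<Sum>m<N. Q m (x - a)))
        (\<lambda>x. f x + g x) sequentially"
      by (intro uniform_limit_add uniform_limit_on_subset[OF limP t(2)] uniform_limit_on_subset[OF limQ t(3)])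
    then have "uniform_limit (ball a t) (\<lambda>N x. \<Sum>m<N. P m (x - a) + Q m (x - a))
        (\<lambda>x. f x + g x) sequentially"
      by (simp only: sum.distrib)
    moreover have "(\<lambda>x. P m x + Q m x) \<in> bounded_hom_polys cX cY m" for m
      by (rule hom_poly_add[OF P Q cY])
    moreover have "ball a t \<subseteq> interior (cball 0 1)" using t r by blast
    ultimately show "\<exists>r>0. ball a r \<subseteq> interior (cball 0 1) \<and>
        (\<exists>P. (\<forall>m. P m \<in> bounded_hom_polys cX cY m) \<and>
          uniform_limit (ball a r) (\<lambda>N x. \<Sum>m<N. P m (x - a)) (\<lambda>x. f x + g x) sequentially)"
      using t(1) by (intro exI[of _ t] conjI exI[of _ "\<lambda>m x. P m x + Q m x"]) auto
  qed
  then show ?thesis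
    using f g unfolding A_b_def by (auto intro: bounded_plus_comp continuous_on_add)
qed

lemma A_u_add:
  assumes "normed_space_over cY" "f \<in> A_u cX cY" "g \<in> A_u cX cY"
  shows "(\<lambda>x. f x + g x) \<in> A_u cX cY"
  using assms A_b_add[OF assms(1)] by (auto simp: A_u_def intro: uniformly_continuous_on_add)

section \<open>Peaks at strongly exposed points\<close>

lemma strongly_exposed_point_uniform:
  assumes "strongly_exposed_point s x"
  obtains \<phi> where "\<phi> \<in> dual_space s" "onorm \<phi> \<le> 1" "\<phi> x = 1"
    "\<And>r. r > 0 \<Longrightarrow> \<exists>d>0. \<forall>z\<in>cball 0 1. re_part (\<phi> z) \<ge> 1 - d \<longrightarrow> norm (z - x) < r"
proof -
  obtain \<phi> where \<phi>: "\<phi> \<in> dual_space s" "onorm \<phi> \<le> 1" "\<phi> x = 1"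
    and seq: "\<And>u :: nat \<Rightarrow> 'b. \<lbrakk>range u \<subseteq> cball 0 1; (\<lambda>n. re_part (\<phi> (u n))) \<longlonglongrightarrow> 1\<rbrakk> \<Longrightarrow>
      (\<lambda>n. norm (u n - x)) \<longlonglongrightarrow> 0"
    using assms unfolding strongly_exposed_point_def by blast
  have "\<exists>d>0. \<forall>z\<in>cball 0 1. re_part (\<phi> z) \<ge> 1 - d \<longrightarrow> norm (z - x) < r" if r: "r > 0" for r
  proof (rule ccontr)
    assume neg: "\<not> ?thesis"
    \<comment> \<open>Failure for every \<open>d = 1 / real (Suc n)\<close> yields a sequence
      staying away from \<open>x\<close>, whose real parts are squeezed to 1, against
      exposure.\<close>
    have "\<exists>z\<in>cball 0 1. re_part (\<phi> z) \<ge> 1 - 1 / real (Suc n) \<and> norm (z - x) \<ge> r" for n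
    proof -
      have "1 / real (Suc n) > 0" by simp
      with neg show ?thesis by (meson not_less)
    qed
    then obtain u where u: "\<And>n. u n \<in> cball 0 1" "\<And>n. re_part (\<phi> (u n)) \<ge> 1 - 1 / real (Suc n)"
      "\<And>n. norm (u n - x) \<ge> r"
      by metis
    have "re_part (\<phi> (u n)) \<le> 1" for n
    proof -
      have "(re_part (\<phi> (u n)))\<^sup>2 \<le> (norm (\<phi> (u n)))\<^sup>2" by (simp add: norm_sq_re_im)
      also have "\<dots> \<le> 1" using dual_space_norm_le_1[OF \<phi>(1,2) u(1)] by (simp add: power_le_one)
      finally show ?thesis by (simp add: abs_square_le_1)
    qed
    then have "\<forall>\<^sub>F n in sequentially. re_part (\<phi> (u n)) \<le> 1" by simp
    moreover have "(\<lambda>n. 1 - 1 / real (Suc n)) \<longlonglongrightarrow> 1 - 0"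
      by (intro tendsto_intros LIMSEQ_Suc lim_1_over_n)
    moreover have "\<forall>\<^sub>F n in sequentially. 1 - 1 / real (Suc n) \<le> re_part (\<phi> (u n))"
      using u(2) by (intro always_eventually allI)
    ultimately have "(\<lambda>n. re_part (\<phi> (u n))) \<longlonglongrightarrow> 1"
      using tendsto_sandwich[of "\<lambda>n. 1 - 1 / real (Suc n)" _ sequentially "\<lambda>n. 1" 1] by simp
    then have "(\<lambda>n. norm (u n - x)) \<longlonglongrightarrow> 0" using u(1) by (intro seq) blast+
    then have "r \<le> 0" by (rule LIMSEQ_le_const) (use u(3) in blast)
    with r show False by simp
  qed
  with that \<phi> show ?thesis by blast
qed

text \<open>In the expansion of \<open>(norm (1 + w))\<^sup>2\<close> the term
  \<open>(norm w)\<^sup>2\<close> is at most 1. So a modulus of \<open>(1 + w) / 2\<close> close to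
  1 forces a real part of \<open>w\<close> close to 1, which is what strong exposure
  measures.\<close>

lemma norm_half_one_plus_sq:
  assumes "norm (w::complex) \<le> 1"
  shows "(norm ((1 + w) / 2))\<^sup>2 \<le> (1 + Re w) / 2"
proof -
  have "(norm w)\<^sup>2 \<le> 1" using assms by (simp add: power_le_one)
  moreover have "(norm (1 + w))\<^sup>2 = 1 + 2 * Re w + (norm w)\<^sup>2"
    unfolding cmod_power2 by (simp add: power2_eq_square algebra_simps)
  ultimately show ?thesis by (simp add: norm_divide power_divide)
qed

text \<open>Since \<open>N\<close> is chosen after the functional and its \<open>d\<close>, the
  threshold can be \<open>1 / 2\<close> for every point. The exponent found is \<open>2 * n\<close>
  because the modulus estimate is for the square.\<close>

lemma strongly_exposed_point_peak:
  fixes cX :: "complex \<Rightarrow> 'a::real_normed_vector \<Rightarrow> 'a"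
  assumes "strongly_exposed_point cX x" "r > 0"
  obtains \<phi> N where "\<phi> \<in> dual_space cX" "onorm \<phi> \<le> 1" "\<phi> x = 1"
    "\<And>z. \<lbrakk>z \<in> cball 0 1; norm (((1 + \<phi> z) / 2) ^ N) > 1 / 2\<rbrakk> \<Longrightarrow> norm (z - x) < r"
proof -
  obtain \<phi> where \<phi>: "\<phi> \<in> dual_space cX" "onorm \<phi> \<le> 1" "\<phi> x = 1"
    "\<And>r. r > 0 \<Longrightarrow> \<exists>d>0. \<forall>z\<in>cball 0 1. re_part (\<phi> z) \<ge> 1 - d \<longrightarrow> norm (z - x) < r"
    by (rule strongly_exposed_point_uniform[OF assms(1)]) blast
  obtain d where d: "d > 0" "\<And>z. \<lbrakk>z \<in> cball 0 1; Re (\<phi> z) \<ge> 1 - d\<rbrakk> \<Longrightarrow> norm (z - x) < r"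
    using \<phi>(4)[OF assms(2)] by (auto simp: re_part_complex_def)
  obtain n where n: "(1 - d / 2) ^ n < 1 / 2"
    using real_arch_pow_inv[of "1/2" "1 - d / 2"] d by auto
  have "norm (z - x) < r" if z: "z \<in> cball 0 1" and p: "norm (((1 + \<phi> z) / 2) ^ (2 * n)) > 1 / 2" for z
  proof (rule d(2)[OF z], rule ccontr)
    assume "\<not> Re (\<phi> z) \<ge> 1 - d"
    then have "(norm ((1 + \<phi> z) / 2))\<^sup>2 \<le> 1 - d / 2"
      using norm_half_one_plus_sq[OF dual_space_norm_le_1[OF \<phi>(1,2) z]] by simp
    then have "((norm ((1 + \<phi> z) / 2))\<^sup>2) ^ n \<le> (1 - d / 2) ^ n" by (intro power_mono) auto
    with n p show False by (simp add: norm_power power_mult)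
  qed
  with that \<phi> show ?thesis by blast
qed

text \<open>Formulated for any \<open>F\<close> inside \<open>A_b\<close> that is stable under
  adding members of \<open>A_u\<close>, so that both spaces are instances.\<close>

theorem norm_attaining_analytic_dense:
  fixes cX :: "complex \<Rightarrow> 'a::banach \<Rightarrow> 'a" and cY :: "complex \<Rightarrow> 'b::banach \<Rightarrow> 'b"
  assumes cX: "normed_space_over cX" and cY: "normed_space_over cY"
    and dense: "sphere 0 1 \<subseteq> closure {x. strongly_exposed_point cX x}" and nontriv: "\<exists>x::'a. x \<noteq> 0"
    and F: "F \<subseteq> A_b cX cY" "\<And>f g. \<lbrakk>f \<in> F; g \<in> A_u cX cY\<rbrakk> \<Longrightarrow> (\<lambda>x. f x + g x) \<in> F"
  shows "sup_norm_dense_in {f \<in> F. norm_attaining f} F"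
proof -
  define \<Phi> where "\<Phi> = {(\<lambda>z. ((1 + \<phi> z) / 2) ^ N) | \<phi> N. \<phi> \<in> dual_space cX \<and> onorm \<phi> \<le> 1}"
  show ?thesis
  proof (rule norm_attaining_dense_by_bumps[OF cY, where \<Phi> = \<Phi>])
    fix f assume "f \<in> F"
    with F(1) show "bounded (f ` cball 0 1)" "continuous_on (cball 0 1) f" by (auto simp: A_b_def)
  next
    fix \<phi> :: "'a \<Rightarrow> complex" and z :: 'a assume "\<phi> \<in> \<Phi>" and z: "z \<in> cball 0 1"
    then obtain \<psi> N where \<psi>: "\<psi> \<in> dual_space cX" "onorm \<psi> \<le> 1" "\<phi> = (\<lambda>z. ((1 + \<psi> z) / 2) ^ N)"
      by (auto simp: \<Phi>_def)
    show "norm (\<phi> z) \<le> 1"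
      unfolding \<psi>(3) norm_power
      by (intro power_le_one norm_ge_zero norm_half_one_plus_le_1 dual_space_norm_le_1[OF \<psi>(1,2) z])
  next
    fix f and \<phi> :: "nat \<Rightarrow> 'a \<Rightarrow> complex" and v :: "nat \<Rightarrow> 'b"
    assume f: "f \<in> F" and "\<And>k. \<phi> k \<in> \<Phi>" and v: "summable (\<lambda>k. norm (v k))"
    then have "\<exists>\<psi> N. \<psi> \<in> dual_space cX \<and> onorm \<psi> \<le> 1 \<and> \<phi> k = (\<lambda>z. ((1 + \<psi> z) / 2) ^ N)" for k
      unfolding \<Phi>_def by blast
    then obtain \<psi> N where \<psi>: "\<And>k. \<psi> k \<in> dual_space cX" "\<And>k. onorm (\<psi> k) \<le> 1"
      "\<And>k. \<phi> k = (\<lambda>z. ((1 + \<psi> k z) / 2) ^ N k)"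
      by metis
    show "(\<lambda>z. f z + (\<Sum>k. cY (\<phi> k z) (v k))) \<in> F"
      unfolding \<psi>(3) by (intro F(2)[OF f] suminf_peaks_A_u[OF cX cY \<psi>(1,2) v])
  next
    fix r :: real assume r: "r > 0"
    have "\<exists>x\<in>cball 0 1. \<exists>\<phi>\<in>\<Phi>. sup_norm f - \<eta> < norm (f x) \<and> \<phi> x = 1 \<and> peaks_within F \<phi> (1/2) r"
      if f: "f \<in> F" and \<eta>: "\<eta> > 0" for f \<eta>
    proof -
      obtain z where z: "z \<in> cball 0 1" "norm (f z) > sup_norm f - \<eta> / 2"
        using ex_norm_gt_sup_norm_minus[of "\<eta> / 2" f] \<eta> by auto
      obtain w where w: "w \<in> sphere 0 1" "norm (f z) \<le> norm (f w)"
        using A_b_max_on_sphere[OF cX cY _ nontriv z(1)] f F(1) by blast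
      have "continuous_on (cball 0 1) f" "w \<in> cball 0 1" using f F(1) w(1) by (auto simp: A_b_def)
      then obtain d where d: "d > 0" "\<And>x. x \<in> cball 0 1 \<Longrightarrow> dist x w < d \<Longrightarrow> dist (f x) (f w) < \<eta> / 2"
        unfolding continuous_on_iff using \<eta> by (meson half_gt_zero)
      obtain x where x: "strongly_exposed_point cX x" "dist x w < d"
        using w(1) dense d(1) closure_approachable by blast
      have xB: "x \<in> cball 0 1" using x(1) by (simp add: strongly_exposed_point_def)
      have "dist (f x) (f w) < \<eta> / 2" by (rule d(2)[OF xB x(2)])
      then have "norm (f w) - norm (f x) < \<eta> / 2"
        using norm_triangle_ineq2[of "f w" "f x"] by (simp add: dist_norm norm_minus_commute)
      with z w have fx: "sup_norm f - \<eta> < norm (f x)" by linarith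
      obtain \<phi> N where \<phi>: "\<phi> \<in> dual_space cX" "onorm \<phi> \<le> 1" "\<phi> x = 1"
        and p: "\<And>z. \<lbrakk>z \<in> cball 0 1; norm (((1 + \<phi> z) / 2) ^ N) > 1 / 2\<rbrakk> \<Longrightarrow> norm (z - x) < r / 2"
        using strongly_exposed_point_peak[OF x(1), of "r / 2"] r by auto
      have "peaks_within F (\<lambda>z. ((1 + \<phi> z) / 2) ^ N) (1/2) r"
        unfolding peaks_within_def
      proof (intro ballI impI)
        fix y y' assume y: "y \<in> cball 0 1" "y' \<in> cball 0 1"
          "1 - 1/2 < norm (((1 + \<phi> y) / 2) ^ N) \<and> 1 - 1/2 < norm (((1 + \<phi> y') / 2) ^ N)"
        have "norm (y - x) < r / 2" "norm (y' - x) < r / 2" using p y by auto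
        then have "norm (y' - y) < r"
          using norm_triangle_ineq4[of "y' - x" "y - x"] by simp
        with y show "\<exists>z''\<in>cball 0 1. (\<forall>g\<in>F. norm (g z'') = norm (g y')) \<and> norm (z'' - y) < r"
          by blast
      qed
      moreover have "(\<lambda>z. ((1 + \<phi> z) / 2) ^ N) \<in> \<Phi>" using \<phi> by (auto simp: \<Phi>_def)
      ultimately show ?thesis
        using fx xB \<phi>(3) by (intro bexI[of _ x] bexI[of _ "\<lambda>z. ((1 + \<phi> z) / 2) ^ N"]) auto
    qed
    then show "\<exists>t>0. \<forall>f\<in>F. \<forall>\<eta>>0. \<exists>x\<in>cball 0 1. \<exists>\<phi>\<in>\<Phi>.
        sup_norm f - \<eta> < norm (f x) \<and> \<phi> x = 1 \<and> peaks_within F \<phi> t r"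
      by (intro exI[of _ "1/2"]) simp
  qed
qed

section \<open>Density of the norm-attaining functions\<close>

theorem theorem5p4:
  fixes sX :: "'k::real_or_complex \<Rightarrow> 'x::banach \<Rightarrow> 'x"
    and sY :: "'k \<Rightarrow> 'y::banach \<Rightarrow> 'y"
    and cX :: "complex \<Rightarrow> 'u::banach \<Rightarrow> 'u"
    and cY :: "complex \<Rightarrow> 'v::banach \<Rightarrow> 'v"
    and n :: nat
  shows "(normed_space_over sX \<and> normed_space_over sY \<and> n \<ge> 1 \<longrightarrow>
      (\<forall>E. uniformly_strongly_exposed sX E \<and> norming sX sY n E \<longrightarrow>
        sup_norm_dense_in {P \<in> bounded_hom_polys sX sY n. norm_attaining P}
          (bounded_hom_polys sX sY n)) \<and>
      (\<forall>E. uniformly_strongly_exposed sX E \<and> sphere 0 1 \<subseteq> closure E \<longrightarrow>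
        sup_norm_dense_in {P \<in> bounded_hom_polys sX sY n. norm_attaining P}
          (bounded_hom_polys sX sY n)))
    \<and> (normed_space_over cX \<and> normed_space_over cY \<and>
        sphere 0 1 \<subseteq> closure {x. strongly_exposed_point cX x} \<longrightarrow>
      sup_norm_dense_in {f \<in> A_u cX cY. norm_attaining f} (A_u cX cY) \<and>
      sup_norm_dense_in {f \<in> A_b cX cY. norm_attaining f} (A_b cX cY))"
proof (intro conjI impI)
  assume A: "normed_space_over sX \<and> normed_space_over sY \<and> n \<ge> 1"
  then have sX: "normed_space_over sX" and sY: "normed_space_over sY" and n: "n \<ge> 1" by auto
  let ?P = "bounded_hom_polys sX sY n"
  \<comment> \<open>Norming and dense sets are handled together: either kind contains points where
    the norm is almost attained, and these are what the perturbation needs.\<close>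
  have main: "sup_norm_dense_in {P \<in> ?P. norm_attaining P} ?P"
    if E: "uniformly_strongly_exposed sX E" "E \<noteq> {} \<and> norming sX sY n E \<or> sphere 0 1 \<subseteq> closure E"
      and nontriv: "\<exists>x::'x. x \<noteq> 0" for E
  proof (rule norm_attaining_hom_polys_dense[OF sX sY n E(1)])
    fix P \<eta> assume P: "P \<in> ?P" and \<eta>: "(\<eta>::real) > 0"
    have "E \<subseteq> sphere 0 1" using E(1) by (simp add: uniformly_strongly_exposed_def)
    then show "\<exists>x\<in>E. sup_norm P - \<eta> < norm (P x)"
      using E(2) norming_almost_max[OF _ _ P \<eta>] hom_poly_almost_max_on_dense[OF sX sY n P nontriv _ _ \<eta>]
      by blast
  qed
  show "\<forall>E. uniformly_strongly_exposed sX E \<and> norming sX sY n E \<longrightarrow>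
      sup_norm_dense_in {P \<in> ?P. norm_attaining P} ?P"
  proof (intro allI impI)
    fix E assume E: "uniformly_strongly_exposed sX E \<and> norming sX sY n E"
    show "sup_norm_dense_in {P \<in> ?P. norm_attaining P} ?P"
    proof (cases "E = {}")
      case True
      with E have "norm_attaining P" if "P \<in> ?P" for P
        using norming_empty_norm_attaining[OF sX sY _ that] by blast
      then show ?thesis by (rule sup_norm_dense_in_self)
    next
      case False
      then obtain x where "x \<in> E" by blast
      with E have "norm x = 1" by (auto simp: uniformly_strongly_exposed_def)
      then have "\<exists>x::'x. x \<noteq> 0" by (intro exI[of _ x]) auto
      with main E False show ?thesis by blast
    qed
  qed
  show "\<forall>E. uniformly_strongly_exposed sX E \<and> sphere 0 1 \<subseteq> closure E \<longrightarrow>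
      sup_norm_dense_in {P \<in> ?P. norm_attaining P} ?P"
  proof (cases "\<exists>x::'x. x \<noteq> 0")
    case True
    with main show ?thesis by blast
  next
    case False
    then have "norm_attaining P" for P :: "'x \<Rightarrow> 'y" by (intro norm_attaining_trivial_domain) blast
    then show ?thesis using sup_norm_dense_in_self by blast
  qed
next
  assume A: "normed_space_over cX \<and> normed_space_over cY \<and>
    sphere 0 1 \<subseteq> closure {x. strongly_exposed_point cX x}"
  then have cX: "normed_space_over cX" and cY: "normed_space_over cY"
    and dense: "sphere 0 1 \<subseteq> closure {x. strongly_exposed_point cX x}" by auto
  have main: "sup_norm_dense_in {f \<in> F. norm_attaining f} F"
    if F: "F \<subseteq> A_b cX cY" "\<And>f g. \<lbrakk>f \<in> F; g \<in> A_u cX cY\<rbrakk> \<Longrightarrow> (\<lambda>x. f x + g x) \<in> F" for F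
  proof (cases "\<exists>x::'u. x \<noteq> 0")
    case True
    then show ?thesis by (rule norm_attaining_analytic_dense[OF cX cY dense _ F])
  next
    case False
    then have "norm_attaining f" for f :: "'u \<Rightarrow> 'v" by (intro norm_attaining_trivial_domain) blast
    then show ?thesis by (intro sup_norm_dense_in_self)
  qed
  have "A_u cX cY \<subseteq> A_b cX cY" by (auto simp: A_u_def)
  then show "sup_norm_dense_in {f \<in> A_u cX cY. norm_attaining f} (A_u cX cY)"
    and "sup_norm_dense_in {f \<in> A_b cX cY. norm_attaining f} (A_b cX cY)"
    using A_u_add[OF cY] A_b_add[OF cY] by (intro main; blast)+
qed

end
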